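(* For every composition $\eta$ and $1\le i\le n-1$, $x^{\underline{s_i\eta}}=\sigma_i^+(x^{\underline\eta})$ and $x^{\underline{\Phi\eta}}=\Phi^+(x^{\underline\eta})$.
   Context: Fix $n\ge1$; $r$ is an indeterminate, $\alpha=1/r$, $\mathbb{F}=\mathbb{Q}(r)$, polynomials in $\mathbb{F}[x_1,\dots,x_n]$. Compositions are $\eta\in\mathbb{N}^n$, $|\eta|=\sum\eta_i$, $x^\eta=\prod x_i^{\eta_i}$; partitions are weakly decreasing compositions; $\delta=(n-1,\dots,0)$; permutations act on vectors by $(wv)_{w(i)}=v_i$; $w_\gamma$ is the minimal-length permutation with $w_\gamma^{-1}(\gamma)$ a partition, $\overline\gamma=\gamma+w_\gamma(r\delta)$. $E_\eta^{r\delta}$ is the unique polynomial of degree $|\eta|$ vanishing at all $\overline\gamma$ with $\gamma\ne\eta$, $|\gamma|\le|\eta|$, with coefficient $1$ on $x^\eta$; $E_\eta^{(\alpha)}$ its top homogeneous component. With $a_\eta(i,j)=\eta_i-j$, $l_\eta(i,j)=\#\{k>i:j\le\eta_k\le\eta_i\}+\#\{k<i:j\le\eta_k+1\le\eta_i\}$, $d_\eta(\alpha)=\prod_{1\le j\le\eta_i}(\alpha(a_\eta(i,j)+1)+l_\eta(i,j)+1)$, set $F_\eta^{(\alpha)}=d_\eta E_\eta^{(\alpha)}$, $F_\eta^{r\delta}(x)=(-1)^{|\eta|}d_\eta E_\eta^{r\delta}(-x)$; $\Xi$ is the unique $\mathbb{F}$-linear operator with $\Xi(F_\eta^{(\alpha)})=F_\eta^{r\delta}$;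 $x^{\underline\eta}=\Xi(x^\eta)$. On compositions, $s_i\eta$ swaps $\eta_i,\eta_{i+1}$ and $\Phi\eta=(\eta_2,\dots,\eta_n,\eta_1+1)$. On polynomials, $s_i$ swaps $x_i,x_{i+1}$, $\partial_if=(s_if-f)/(x_i-x_{i+1})$, $\sigma_i^+=s_i+r\partial_i$, $\Phi^+f(x)=x_nf(x_n+1,x_1,\dots,x_{n-1})$. *)

theory Defs
  imports
    "HOL-Library.Poly_Mapping"
    "HOL-Library.FuncSet"
    "HOL-Combinatorics.Permutations"
    "HOL-Computational_Algebra.Polynomial"
    "HOL-Computational_Algebra.Fraction_Field"
begin

section \<open>Coefficients, polynomials, compositions\<close>

type_synonym ratfun = "rat poly fract"

definition r :: ratfun where "r = Fract [:0, 1:] 1"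

definition alpha :: ratfun where "alpha = 1 / r"

text \<open>Variables are indexed by natural numbers; those in use are \<open>1, \<dots>, n\<close>. An exponent vector
  is a finitely supported function, and a composition in \<open>n\<close> parts is an exponent vector
  supported in \<open>{1..n}\<close>, so that the monomial of a composition is the monomial with that key.\<close>

type_synonym expo = "nat \<Rightarrow>\<^sub>0 nat"

type_synonym mpoly = "expo \<Rightarrow>\<^sub>0 ratfun"

definition compositions :: "nat \<Rightarrow> expo set" where
  "compositions n = {\<eta>. Poly_Mapping.keys \<eta> \<subseteq> {1..n}}"

definition weight :: "expo \<Rightarrow> nat" where
  "weight \<eta> = (\<Sum>i\<in>Poly_Mapping.keys \<eta>. Poly_Mapping.lookup \<eta> i)"

definition polys :: "nat \<Rightarrow> mpoly set" where
  "polys n = {p. Poly_Mapping.keys p \<subseteq> compositions n}"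

definition Const :: "ratfun \<Rightarrow> mpoly" where "Const c = Poly_Mapping.single 0 c"

definition monom_of :: "expo \<Rightarrow> mpoly" where "monom_of \<eta> = Poly_Mapping.single \<eta> 1"

definition Var :: "nat \<Rightarrow> mpoly" where "Var i = monom_of (Poly_Mapping.single i 1)"

definition total_degree :: "mpoly \<Rightarrow> nat" where
  "total_degree p = Max (insert 0 (weight ` Poly_Mapping.keys p))"

definition top_component :: "mpoly \<Rightarrow> mpoly" where
  "top_component p = (\<Sum>m\<in>{m \<in> Poly_Mapping.keys p. weight m = total_degree p}.
     Poly_Mapping.single m (Poly_Mapping.lookup p m))"

definition peval :: "(nat \<Rightarrow> ratfun) \<Rightarrow> mpoly \<Rightarrow> ratfun" where
  "peval v p = (\<Sum>m\<in>Poly_Mapping.keys p. Poly_Mapping.lookup p m *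
     (\<Prod>i\<in>Poly_Mapping.keys m. v i ^ Poly_Mapping.lookup m i))"

definition psubst :: "(nat \<Rightarrow> mpoly) \<Rightarrow> mpoly \<Rightarrow> mpoly" where
  "psubst g p = (\<Sum>m\<in>Poly_Mapping.keys p. Const (Poly_Mapping.lookup p m) *
     (\<Prod>i\<in>Poly_Mapping.keys m. g i ^ Poly_Mapping.lookup m i))"

section \<open>The interpolation points\<close>

text \<open>\<open>(w v)\<^bsub>w(i)\<^esub> = v\<^sub>i\<close>\<close>

definition perm_act :: "(nat \<Rightarrow> nat) \<Rightarrow> (nat \<Rightarrow> 'a) \<Rightarrow> nat \<Rightarrow> 'a" where
  "perm_act w v = (\<lambda>j. v (inv w j))"

definition weakly_decreasing :: "nat \<Rightarrow> (nat \<Rightarrow> nat) \<Rightarrow> bool" where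
  "weakly_decreasing n v \<longleftrightarrow> (\<forall>i j. 1 \<le> i \<and> i \<le> j \<and> j \<le> n \<longrightarrow> v j \<le> v i)"

text \<open>The Coxeter length of a permutation is its number of inversions.\<close>

definition perm_length :: "nat \<Rightarrow> (nat \<Rightarrow> nat) \<Rightarrow> nat" where
  "perm_length n w = card {(i, j). 1 \<le> i \<and> i < j \<and> j \<le> n \<and> w j < w i}"

definition min_perm :: "nat \<Rightarrow> expo \<Rightarrow> nat \<Rightarrow> nat" where
  "min_perm n \<gamma> = (THE w. is_arg_min (perm_length n)
     (\<lambda>w. w permutes {1..n} \<and> weakly_decreasing n (perm_act (inv w) (Poly_Mapping.lookup \<gamma>))) w)"

definition delta :: "nat \<Rightarrow> nat \<Rightarrow> nat" where "delta n i = n - i"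

text \<open>Only the entries at \<open>1, \<dots>, n\<close> matter: \<open>point n \<gamma>\<close> is only used to evaluate
  elements of \<open>polys n\<close>.\<close>

definition point :: "nat \<Rightarrow> expo \<Rightarrow> nat \<Rightarrow> ratfun" where
  "point n \<gamma> = (\<lambda>i. of_nat (Poly_Mapping.lookup \<gamma> i) +
     perm_act (min_perm n \<gamma>) (\<lambda>j. r * of_nat (delta n j)) i)"

section \<open>Interpolation polynomials and nonsymmetric Jack polynomials\<close>

definition E_interp :: "nat \<Rightarrow> expo \<Rightarrow> mpoly" where
  "E_interp n \<eta> = (THE p. p \<in> polys n \<and> total_degree p = weight \<eta> \<and>
     (\<forall>\<gamma>\<in>compositions n. \<gamma> \<noteq> \<eta> \<and> weight \<gamma> \<le> weight \<eta> \<longrightarrow> peval (point n \<gamma>) p = 0) \<and>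
     Poly_Mapping.lookup p \<eta> = 1)"

definition E_jack :: "nat \<Rightarrow> expo \<Rightarrow> mpoly" where
  "E_jack n \<eta> = top_component (E_interp n \<eta>)"

definition arm :: "expo \<Rightarrow> nat \<Rightarrow> nat \<Rightarrow> nat" where
  "arm \<eta> i j = Poly_Mapping.lookup \<eta> i - j"

definition leg :: "nat \<Rightarrow> expo \<Rightarrow> nat \<Rightarrow> nat \<Rightarrow> nat" where
  "leg n \<eta> i j =
     card {k \<in> {1..n}. i < k \<and> j \<le> Poly_Mapping.lookup \<eta> k \<and>
       Poly_Mapping.lookup \<eta> k \<le> Poly_Mapping.lookup \<eta> i} +
     card {k \<in> {1..n}. k < i \<and> j \<le> Poly_Mapping.lookup \<eta> k + 1 \<and>
       Poly_Mapping.lookup \<eta> k + 1 \<le> Poly_Mapping.lookup \<eta> i}"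

definition d_const :: "nat \<Rightarrow> expo \<Rightarrow> ratfun" where
  "d_const n \<eta> = (\<Prod>i\<in>{1..n}. \<Prod>j\<in>{1..Poly_Mapping.lookup \<eta> i}.
     alpha * of_nat (arm \<eta> i j + 1) + of_nat (leg n \<eta> i j) + 1)"

definition F_jack :: "nat \<Rightarrow> expo \<Rightarrow> mpoly" where
  "F_jack n \<eta> = Const (d_const n \<eta>) * E_jack n \<eta>"

definition F_interp :: "nat \<Rightarrow> expo \<Rightarrow> mpoly" where
  "F_interp n \<eta> = Const ((-1) ^ weight \<eta> * d_const n \<eta>) * psubst (\<lambda>i. - Var i) (E_interp n \<eta>)"

section \<open>The operator \<open>\<Xi>\<close> and the factorial monomials\<close>

text \<open>The operator acts on polynomials in \<open>n\<close> variables only; \<open>\<rightarrow>\<^sub>E\<close> fixes its value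
  to \<open>undefined\<close> elsewhere, so that uniqueness is meaningful.\<close>

definition Xi :: "nat \<Rightarrow> mpoly \<Rightarrow> mpoly" where
  "Xi n = (THE X. X \<in> polys n \<rightarrow>\<^sub>E polys n \<and>
     (\<forall>p\<in>polys n. \<forall>q\<in>polys n. X (p + q) = X p + X q) \<and>
     (\<forall>c. \<forall>p\<in>polys n. X (Const c * p) = Const c * X p) \<and>
     (\<forall>\<eta>\<in>compositions n. X (F_jack n \<eta>) = F_interp n \<eta>))"

definition fact_monom :: "nat \<Rightarrow> expo \<Rightarrow> mpoly" where
  "fact_monom n \<eta> = Xi n (monom_of \<eta>)"

section \<open>Operators on compositions and on polynomials\<close>

definition swap_comp :: "nat \<Rightarrow> expo \<Rightarrow> expo" where
  "swap_comp i \<eta> = Poly_Mapping.map_key (transpose i (Suc i)) \<eta>"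

definition Phi :: "nat \<Rightarrow> expo \<Rightarrow> expo" where
  "Phi n \<eta> = Abs_poly_mapping (\<lambda>i.
     if i = n then Poly_Mapping.lookup \<eta> 1 + 1
     else if 1 \<le> i \<and> i < n then Poly_Mapping.lookup \<eta> (i + 1)
     else 0)"

definition swap_poly :: "nat \<Rightarrow> mpoly \<Rightarrow> mpoly" where
  "swap_poly i = psubst (\<lambda>j. Var (transpose i (Suc i) j))"

text \<open>The exact quotient \<open>(s\<^sub>i f - f) / (x\<^sub>i - x\<^bsub>i+1\<^esub>)\<close>; polynomials form an integral
  domain, so it is unique.\<close>

definition divdiff :: "nat \<Rightarrow> mpoly \<Rightarrow> mpoly" where
  "divdiff i f = (THE g. (Var i - Var (Suc i)) * g = swap_poly i f - f)"

definition sigma_plus :: "nat \<Rightarrow> mpoly \<Rightarrow> mpoly" where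
  "sigma_plus i f = swap_poly i f + Const r * divdiff i f"

definition Phi_plus :: "nat \<Rightarrow> mpoly \<Rightarrow> mpoly" where
  "Phi_plus n f = Var n * psubst (\<lambda>i. if i = 1 then Var n + 1 else Var (i - 1)) f"

lemma lookup_swap_comp:
  "Poly_Mapping.lookup (swap_comp i \<eta>) j = Poly_Mapping.lookup \<eta> (transpose i (Suc i) j)"
  by (simp add: swap_comp_def map_key.rep_eq)

lemma lookup_Phi:
  "Poly_Mapping.lookup (Phi n \<eta>) i =
     (if i = n then Poly_Mapping.lookup \<eta> 1 + 1
      else if 1 \<le> i \<and> i < n then Poly_Mapping.lookup \<eta> (i + 1)
      else 0)"
proof -
  have "finite {i. (if i = n then Poly_Mapping.lookup \<eta> 1 + 1
      else if 1 \<le> i \<and> i < n then Poly_Mapping.lookup \<eta> (i + 1) else 0) \<noteq> 0}"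
    by (rule finite_subset[of _ "{..n}"]) (auto split: if_splits)
  then show ?thesis
    unfolding Phi_def by (subst lookup_Abs_poly_mapping) simp_all
qed

end

(* Since d_eta is non-zero, it cancels in the definition of Xi: the operator sends the top component
   of E_eta to (-1)^|eta| E_eta(-x).  Hence the factorial monomial of eta is the unique polynomial of
   the form x^eta + (lower degree) that vanishes at the negatives of all interpolation points of
   weight less than |eta|.  The operators sigma_i^+ and Phi^+ visibly respect this characterisation,
   because the interpolation points are permuted by s_i (or satisfy x_i - x_(i+1) = r when the two
   entries agree) and because the points with last coordinate non-zero are the images of points of
   smaller weight under Phi.

   Existence and uniqueness of all interpolation polynomials reduce to the invertibility of square
   linear systems over Q(r).  These are specialised at r = 0, where the interpolation points become
   the compositions themselves and falling factorials make the system triangular. *)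

theory Submission
  imports Defs "HOL-Computational_Algebra.Polynomial_Factorial"
begin


text \<open>The polynomials E_eta are normalised by a coefficient at the one composition where no
  vanishing is imposed. Unisolvence is therefore proved for mixed data: values at most points, and
  possibly coefficients of top-degree monomials. Falling factorials suit both kinds, since their top
  homogeneous component is a single monomial: a coefficient condition becomes a row of the identity
  matrix and the triangular shape at r = 0 survives.

  Uniqueness of Xi needs the top components of the E_eta to span. This also follows from
  interpolation: a polynomial x^mu + (lower degree) that vanishes at all points of smaller weight is
  a combination of the E_eta with |eta| = |mu|, and taking top components expresses x^mu.

  The constants in the two operators are dictated by the points. Equal neighbouring entries give
  coordinates that differ by r, the coefficient of the divided difference; Phi raises one coordinate
  by 1, and at the negated point the shift x_n + 1 undoes this. The factor x_n takes care of the
  compositions with last entry 0, which are not in the image of Phi.\<close>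

abbreviation lookup where "lookup \<equiv> Poly_Mapping.lookup"
abbreviation keys where "keys \<equiv> Poly_Mapping.keys"
abbreviation single where "single \<equiv> Poly_Mapping.single"

section \<open>Polynomial algebra: substitution, degree filtration, leading terms\<close>

section \<open>Substitution homomorphisms\<close>

text \<open>\<open>peval\<close> and \<open>psubst\<close> differ only in how coefficients are
  mapped into the target ring, so the homomorphism laws are proved once for this common
  form.\<close>

definition hom_eval :: "(ratfun \<Rightarrow> 'b::comm_ring_1) \<Rightarrow> (nat \<Rightarrow> 'b) \<Rightarrow> mpoly \<Rightarrow> 'b" where
  "hom_eval h g p = (\<Sum>m\<in>keys p. h (lookup p m) * (\<Prod>i\<in>keys m. g i ^ lookup m i))"

lemma peval_hom: "peval v = hom_eval (\<lambda>x. x) v"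
  by (simp add: peval_def hom_eval_def fun_eq_iff)

lemma psubst_hom: "psubst g = hom_eval Const g"
  by (simp add: psubst_def hom_eval_def fun_eq_iff)

definition is_ring_hom :: "(ratfun \<Rightarrow> 'b::comm_ring_1) \<Rightarrow> bool" where
  "is_ring_hom h \<longleftrightarrow> h 0 = 0 \<and> h 1 = 1 \<and> (\<forall>a b. h (a + b) = h a + h b) \<and> (\<forall>a b. h (a * b) = h a * h b)"

lemma is_ring_hom_id: "is_ring_hom (\<lambda>x. x)"
  by (simp add: is_ring_hom_def)

lemma Const_0 [simp]: "Const 0 = 0" and Const_1 [simp]: "Const 1 = 1"
  and Const_add: "Const (a + b) = Const a + Const b"
  and Const_mult: "Const (a * b) = Const a * Const b"
  and Const_uminus: "Const (- a) = - Const a"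
  by (simp_all add: Const_def single_add mult_single single_uminus)

lemma is_ring_hom_Const: "is_ring_hom Const"
  by (simp add: is_ring_hom_def Const_add Const_mult)

lemma lookup_Const_mult: "lookup (Const c * p) m = c * lookup p m"
proof -
  have "lookup (Const c * p) m = (\<Sum>l. (c * (\<Sum>q. lookup p q when m = l + q)) when l = 0)"
    unfolding lookup_mult Const_def
    by (rule Sum_any.cong) (auto simp: lookup_single when_def)
  then show ?thesis
    by simp
qed

lemma keys_Const_mult: "keys (Const c * p) \<subseteq> keys p"
  by (auto simp: in_keys_iff lookup_Const_mult)

lemma monom_sum: "p = (\<Sum>m\<in>keys p. Const (lookup p m) * monom_of m)"
proof (rule poly_mapping_eqI)
  fix k
  have "lookup (\<Sum>m\<in>keys p. Const (lookup p m) * monom_of m) k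
    = (\<Sum>m\<in>keys p. if m = k then lookup p m else 0)"
    unfolding lookup_sum
    by (rule sum.cong) (auto simp: lookup_Const_mult monom_of_def lookup_single)
  also have "\<dots> = lookup p k"
    by (simp add: in_keys_iff)
  finally show "lookup p k = lookup (\<Sum>m\<in>keys p. Const (lookup p m) * monom_of m) k" ..
qed

lemma monom_prod: "monom_of m = (\<Prod>i\<in>keys m. Var i ^ lookup m i)"
proof -
  have "Var i ^ k = monom_of (single i k)" for i k
    by (induction k) (simp_all add: Var_def monom_of_def mult_single single_add[symmetric])
  moreover have "(\<Prod>i\<in>A. monom_of (f i)) = monom_of (\<Sum>i\<in>A. f i)" for A :: "nat set" and f
    by (induction A rule: infinite_finite_induct) (simp_all add: monom_of_def mult_single)
  moreover have "(\<Sum>i\<in>keys m. single i (lookup m i)) = m"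
    by (rule poly_mapping_eqI) (auto simp: lookup_sum lookup_single when_def in_keys_iff)
  ultimately show ?thesis by simp
qed

context
  fixes h :: "ratfun \<Rightarrow> 'b::comm_ring_1"
  assumes h: "is_ring_hom h"
begin

lemma hom_eval_0 [simp]: "hom_eval h g 0 = 0"
  by (simp add: hom_eval_def)

lemma hom_eval_add: "hom_eval h g (p + q) = hom_eval h g p + hom_eval h g q"
  unfolding hom_eval_def
  by (rule setsum_keys_plus_distrib) (use h in \<open>auto simp: is_ring_hom_def distrib_right\<close>)

lemma hom_eval_sum: "hom_eval h g (sum f A) = (\<Sum>a\<in>A. hom_eval h g (f a))"
  by (induction A rule: infinite_finite_induct) (simp_all add: hom_eval_add)

lemma hom_eval_single: "hom_eval h g (single m c) = h c * (\<Prod>i\<in>keys m. g i ^ lookup m i)"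
  using h by (simp add: hom_eval_def is_ring_hom_def)

lemma prod_power_lookup_add:
  "(\<Prod>i\<in>keys (a + b). (g i :: 'b) ^ lookup (a + b) i)
    = (\<Prod>i\<in>keys a. g i ^ lookup a i) * (\<Prod>i\<in>keys b. g i ^ lookup b i)"
proof -
  have *: "(\<Prod>i\<in>keys c. g i ^ lookup c i) = (\<Prod>i\<in>keys a \<union> keys b. g i ^ lookup c i)"
    if "keys c \<subseteq> keys a \<union> keys b" for c
    using that by (intro prod.mono_neutral_left) (auto simp: in_keys_iff)
  show ?thesis
    by (subst (1 2 3) *) (auto simp: keys_add lookup_add power_add prod.distrib intro: subsetD[OF keys_add])
qed

lemma hom_eval_single_mult:
  "hom_eval h g (single m c * single l d) = hom_eval h g (single m c) * hom_eval h g (single l d)"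
  using h by (simp add: mult_single hom_eval_single prod_power_lookup_add is_ring_hom_def)

lemma Const_monom: "Const c * monom_of m = single m c"
  by (simp add: Const_def monom_of_def mult_single)

lemma hom_eval_mult: "hom_eval h g (p * q) = hom_eval h g p * hom_eval h g q"
proof -
  have "p * q = (\<Sum>m\<in>keys p. \<Sum>l\<in>keys q. single m (lookup p m) * single l (lookup q l))"
    by (subst monom_sum[of p], subst monom_sum[of q]) (simp only: Const_monom sum_product)
  then have "hom_eval h g (p * q) = (\<Sum>m\<in>keys p. hom_eval h g (single m (lookup p m)))
      * (\<Sum>l\<in>keys q. hom_eval h g (single l (lookup q l)))"
    by (simp only: hom_eval_sum hom_eval_single_mult sum_product)
  then show ?thesis
    by (simp only: hom_eval_sum[symmetric] Const_monom[symmetric] monom_sum[symmetric])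
qed

lemma hom_eval_Const: "hom_eval h g (Const c) = h c"
  by (simp add: Const_def hom_eval_single)

lemma hom_eval_1: "hom_eval h g 1 = 1"
  using hom_eval_Const[of g 1] h by (simp add: is_ring_hom_def)

lemma hom_eval_monom: "hom_eval h g (monom_of m) = (\<Prod>i\<in>keys m. g i ^ lookup m i)"
  using h by (simp add: monom_of_def hom_eval_single is_ring_hom_def)

lemma hom_eval_Var: "hom_eval h g (Var i) = g i"
  by (simp add: Var_def hom_eval_monom)

lemma hom_eval_uminus: "hom_eval h g (- p) = - hom_eval h g p"
  using hom_eval_add[of g p "- p"] by (simp add: add_eq_0_iff2)

lemma hom_eval_diff: "hom_eval h g (p - q) = hom_eval h g p - hom_eval h g q"
  using hom_eval_add[of g p "- q"] by (simp add: hom_eval_uminus)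

lemma hom_eval_power: "hom_eval h g (p ^ k) = hom_eval h g p ^ k"
  by (induction k) (simp_all add: hom_eval_1 hom_eval_mult)

lemma hom_eval_prod: "hom_eval h g (prod f A) = (\<Prod>a\<in>A. hom_eval h g (f a))"
  by (induction A rule: infinite_finite_induct) (simp_all add: hom_eval_1 hom_eval_mult)

end

lemmas peval_simps =
  hom_eval_0[OF is_ring_hom_id, folded peval_hom] hom_eval_1[OF is_ring_hom_id, folded peval_hom]
  hom_eval_add[OF is_ring_hom_id, folded peval_hom] hom_eval_mult[OF is_ring_hom_id, folded peval_hom]
  hom_eval_uminus[OF is_ring_hom_id, folded peval_hom] hom_eval_diff[OF is_ring_hom_id, folded peval_hom]
  hom_eval_sum[OF is_ring_hom_id, folded peval_hom] hom_eval_prod[OF is_ring_hom_id, folded peval_hom]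
  hom_eval_Const[OF is_ring_hom_id, folded peval_hom] hom_eval_Var[OF is_ring_hom_id, folded peval_hom]
  hom_eval_power[OF is_ring_hom_id, folded peval_hom]

lemmas psubst_simps =
  hom_eval_0[OF is_ring_hom_Const, folded psubst_hom] hom_eval_1[OF is_ring_hom_Const, folded psubst_hom]
  hom_eval_add[OF is_ring_hom_Const, folded psubst_hom] hom_eval_mult[OF is_ring_hom_Const, folded psubst_hom]
  hom_eval_uminus[OF is_ring_hom_Const, folded psubst_hom] hom_eval_diff[OF is_ring_hom_Const, folded psubst_hom]
  hom_eval_sum[OF is_ring_hom_Const, folded psubst_hom] hom_eval_prod[OF is_ring_hom_Const, folded psubst_hom]
  hom_eval_Const[OF is_ring_hom_Const, folded psubst_hom] hom_eval_Var[OF is_ring_hom_Const, folded psubst_hom]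
  hom_eval_power[OF is_ring_hom_Const, folded psubst_hom]

lemmas psubst_monom = hom_eval_monom[OF is_ring_hom_Const, folded psubst_hom]

lemma peval_psubst: "peval v (psubst g p) = peval (\<lambda>i. peval v (g i)) p"
  by (simp add: psubst_def peval_simps) (simp add: peval_def)

lemma peval_cong:
  assumes "p \<in> polys n" "\<And>i. i \<in> {1..n} \<Longrightarrow> v i = w i"
  shows "peval v p = peval w p"
  unfolding peval_def
proof (intro sum.cong refl arg_cong2[where f = "(*)"] prod.cong)
  fix m i assume "m \<in> keys p" "i \<in> keys m"
  with assms(1) have "i \<in> {1..n}"
    unfolding polys_def compositions_def by blast
  then show "v i ^ lookup m i = w i ^ lookup m i"
    by (simp add: assms(2))
qed

section \<open>Bounded degree\<close>

lemma weight_alt: "finite A \<Longrightarrow> keys \<eta> \<subseteq> A \<Longrightarrow> weight \<eta> = (\<Sum>i\<in>A. lookup \<eta> i)"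
  unfolding weight_def by (rule sum.mono_neutral_left) (auto simp: in_keys_iff)

lemma weight_comp: "\<eta> \<in> compositions n \<Longrightarrow> weight \<eta> = (\<Sum>i\<in>{1..n}. lookup \<eta> i)"
  by (rule weight_alt) (auto simp: compositions_def)

lemma weight_add [simp]: "weight (a + b) = weight a + weight b"
proof -
  have "keys (a + b) \<subseteq> keys a \<union> keys b" by (rule keys_add)
  then show ?thesis
    using weight_alt[of "keys a \<union> keys b" a] weight_alt[of "keys a \<union> keys b" b]
      weight_alt[of "keys a \<union> keys b" "a + b"]
    by (simp add: lookup_add sum.distrib)
qed

lemma weight_0 [simp]: "weight 0 = 0"
  by (simp add: weight_def)

lemma weight_single [simp]: "weight (single i k) = k"
  by (simp add: weight_def)

lemma zero_comp [simp]: "0 \<in> compositions n"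
  by (simp add: compositions_def)

lemma add_comp: "a \<in> compositions n \<Longrightarrow> b \<in> compositions n \<Longrightarrow> a + b \<in> compositions n"
  using keys_add[of a b] by (auto simp: compositions_def)

lemma single_comp: "i \<in> {1..n} \<Longrightarrow> single i k \<in> compositions n"
  by (simp add: compositions_def)

lemma comp_lookup_0: "\<eta> \<in> compositions n \<Longrightarrow> i \<notin> {1..n} \<Longrightarrow> lookup \<eta> i = 0"
  by (auto simp: compositions_def in_keys_iff)

lemma comp_eqI:
  assumes "a \<in> compositions n" "b \<in> compositions n" "\<And>i. i \<in> {1..n} \<Longrightarrow> lookup a i = lookup b i"
  shows "a = b"
  using assms comp_lookup_0 by (metis poly_mapping_eqI)

text \<open>The bound is strict so that \<open>deg_lt n (weight \<mu>)\<close> is the space of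
  lower-order terms below x^mu, which is zero in weight 0. \<open>total_degree\<close> cannot
  express this, being 0 both for the zero polynomial and for nonzero constants.\<close>

definition deg_lt :: "nat \<Rightarrow> nat \<Rightarrow> mpoly set" where
  "deg_lt n d = {p \<in> polys n. \<forall>m\<in>keys p. weight m < d}"

lemma deg_lt_iff: "p \<in> deg_lt n d \<longleftrightarrow> (\<forall>m. lookup p m \<noteq> 0 \<longrightarrow> m \<in> compositions n \<and> weight m < d)"
  by (auto simp: deg_lt_def polys_def in_keys_iff)

lemma polys_iff: "p \<in> polys n \<longleftrightarrow> (\<forall>m. lookup p m \<noteq> 0 \<longrightarrow> m \<in> compositions n)"
  by (auto simp: polys_def in_keys_iff)

lemma deg_lt_polys: "p \<in> deg_lt n d \<Longrightarrow> p \<in> polys n"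
  by (simp add: deg_lt_def)

lemma deg_lt_zero [simp]: "0 \<in> deg_lt n d"
  by (simp add: deg_lt_iff)

lemma deg_lt_0: "p \<in> deg_lt n 0 \<Longrightarrow> p = 0"
  by (metis deg_lt_iff not_less0 lookup_zero poly_mapping_eqI)

lemma deg_lt_add: "p \<in> deg_lt n d \<Longrightarrow> q \<in> deg_lt n d \<Longrightarrow> p + q \<in> deg_lt n d"
  unfolding deg_lt_iff lookup_add by (metis add.right_neutral)

lemma deg_lt_uminus: "p \<in> deg_lt n d \<Longrightarrow> - p \<in> deg_lt n d"
  by (simp add: deg_lt_iff)

lemma deg_lt_diff: "p \<in> deg_lt n d \<Longrightarrow> q \<in> deg_lt n d \<Longrightarrow> p - q \<in> deg_lt n d"
  using deg_lt_add[of p n d "- q"] deg_lt_uminus[of q n d] by simp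

lemma deg_lt_Const_mult: "p \<in> deg_lt n d \<Longrightarrow> Const c * p \<in> deg_lt n d"
  by (simp add: deg_lt_iff lookup_Const_mult)

lemma deg_lt_sum: "(\<And>a. a \<in> A \<Longrightarrow> f a \<in> deg_lt n d) \<Longrightarrow> sum f A \<in> deg_lt n d"
  by (induction A rule: infinite_finite_induct) (auto simp: deg_lt_add)

lemma deg_lt_mono: "p \<in> deg_lt n d \<Longrightarrow> d \<le> e \<Longrightarrow> p \<in> deg_lt n e"
  by (auto simp: deg_lt_iff)

text \<open>One strict and one weak bound add up to a strict bound. The asymmetric form fits a
  lower-order error times a full factor, as in products of polynomials with prescribed leading
  monomials.\<close>

lemma deg_lt_mult: 
  assumes "p \<in> deg_lt n d" "q \<in> deg_lt n (Suc e)"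
  shows "p * q \<in> deg_lt n (d + e)"
  unfolding deg_lt_def polys_def
proof (intro CollectI conjI subsetI ballI)
  fix m assume "m \<in> keys (p * q)"
  with keys_mult[of p q] obtain a b where ab: "m = a + b" "a \<in> keys p" "b \<in> keys q"
    by blast
  then have "a \<in> compositions n" "b \<in> compositions n" "weight a < d" "weight b < Suc e"
    using assms by (auto simp: deg_lt_def polys_def)
  then show "m \<in> compositions n" "weight m < d + e"
    using ab by (auto intro: add_comp)
qed

lemma deg_lt_monom: "\<mu> \<in> compositions n \<Longrightarrow> weight \<mu> < d \<Longrightarrow> monom_of \<mu> \<in> deg_lt n d"
  by (simp add: deg_lt_def polys_def monom_of_def)

lemma polys_zero [simp]: "0 \<in> polys n"
  by (simp add: polys_iff)

lemma polys_add: "p \<in> polys n \<Longrightarrow> q \<in> polys n \<Longrightarrow> p + q \<in> polys n"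
  unfolding polys_iff lookup_add by (metis add.right_neutral)

lemma polys_Const_mult: "p \<in> polys n \<Longrightarrow> Const c * p \<in> polys n"
  by (simp add: polys_iff lookup_Const_mult)

lemma polys_sum: "(\<And>a. a \<in> A \<Longrightarrow> f a \<in> polys n) \<Longrightarrow> sum f A \<in> polys n"
  by (induction A rule: infinite_finite_induct) (auto simp: polys_add)

lemma deg_lt_total_degree:
  "p \<in> polys n \<Longrightarrow> total_degree p = d \<Longrightarrow> p \<in> deg_lt n (Suc d)"
  unfolding deg_lt_def total_degree_def
  by (auto simp: less_Suc_eq_le)

lemma total_degree_eqI:
  assumes "p \<in> deg_lt n (Suc d)" "lookup p m \<noteq> 0" "weight m = d"
  shows "total_degree p = d"
  unfolding total_degree_def using assms
  by (intro Max_eqI) (auto simp: deg_lt_def in_keys_iff less_Suc_eq_le)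

section \<open>Leading monomials\<close>

text \<open>Stronger than a leading term for a monomial order: the whole top homogeneous component
  is x^mu.\<close>

definition has_lead :: "nat \<Rightarrow> expo \<Rightarrow> mpoly \<Rightarrow> bool" where
  "has_lead n \<mu> p \<longleftrightarrow> \<mu> \<in> compositions n \<and> p - monom_of \<mu> \<in> deg_lt n (weight \<mu>)"

lemma has_lead_deg_lt: "has_lead n \<mu> p \<Longrightarrow> p \<in> deg_lt n (Suc (weight \<mu>))"
  using deg_lt_add[OF deg_lt_mono deg_lt_monom, of "p - monom_of \<mu>" n "weight \<mu>" "Suc (weight \<mu>)" \<mu>]
  by (simp add: has_lead_def)

lemma has_lead_monom: "\<mu> \<in> compositions n \<Longrightarrow> has_lead n \<mu> (monom_of \<mu>)"
  by (simp add: has_lead_def)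

lemma has_lead_1: "has_lead n 0 1"
  using has_lead_monom[of 0 n] by (simp add: monom_of_def)

lemma has_lead_Var: "i \<in> {1..n} \<Longrightarrow> has_lead n (single i 1) (Var i)"
  unfolding Var_def by (intro has_lead_monom single_comp)

lemma has_lead_add: "has_lead n \<mu> p \<Longrightarrow> q \<in> deg_lt n (weight \<mu>) \<Longrightarrow> has_lead n \<mu> (p + q)"
  unfolding has_lead_def using deg_lt_add[of "p - monom_of \<mu>" n "weight \<mu>" q]
  by (simp add: algebra_simps)

lemma has_lead_mult:
  assumes "has_lead n \<mu> p" "has_lead n \<nu> q"
  shows "has_lead n (\<mu> + \<nu>) (p * q)"
proof -
  have "p * q - monom_of (\<mu> + \<nu>) = (p - monom_of \<mu>) * q + (q - monom_of \<nu>) * monom_of \<mu>"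
    by (simp add: algebra_simps) (simp add: monom_of_def mult_single add.commute)
  moreover have "(p - monom_of \<mu>) * q \<in> deg_lt n (weight \<mu> + weight \<nu>)"
    using assms by (intro deg_lt_mult has_lead_deg_lt) (auto simp: has_lead_def)
  moreover have "(q - monom_of \<nu>) * monom_of \<mu> \<in> deg_lt n (weight \<nu> + weight \<mu>)"
    using assms by (intro deg_lt_mult deg_lt_monom) (auto simp: has_lead_def)
  ultimately show ?thesis
    using assms by (simp add: has_lead_def add_comp deg_lt_add add.commute)
qed

lemma has_lead_prod:
  "(\<And>i. i \<in> A \<Longrightarrow> has_lead n (\<mu> i) (p i)) \<Longrightarrow> has_lead n (\<Sum>i\<in>A. \<mu> i) (\<Prod>i\<in>A. p i)"
  by (induction A rule: infinite_finite_induct) (auto simp: has_lead_1 has_lead_mult)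

lemma has_lead_power: "has_lead n (single j 1) p \<Longrightarrow> has_lead n (single j k) (p ^ k)"
proof (induction k)
  case (Suc k)
  then show ?case
    using has_lead_mult[of n "single j 1" p "single j k" "p ^ k"] by (simp add: single_add[symmetric])
qed (simp add: has_lead_1)

lemma has_lead_cases: "has_lead n \<mu> p \<Longrightarrow> weight m = weight \<mu> \<Longrightarrow> lookup p m = (if m = \<mu> then 1 else 0)"
proof -
  assume "has_lead n \<mu> p" "weight m = weight \<mu>"
  then have "lookup (p - monom_of \<mu>) m = 0"
    by (metis deg_lt_iff has_lead_def less_irrefl)
  then show ?thesis
    by (auto simp: lookup_minus monom_of_def lookup_single)
qed

lemma weight_sum: "weight (sum f A) = (\<Sum>a\<in>A. weight (f a))"
  by (induction A rule: infinite_finite_induct) auto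

lemma psubst_has_lead_monom:
  assumes "\<mu> \<in> compositions n" "\<And>i. i \<in> {1..n} \<Longrightarrow> has_lead n (single (\<pi> i) 1) (g i)"
  shows "has_lead n (\<Sum>i\<in>{1..n}. single (\<pi> i) (lookup \<mu> i)) (psubst g (monom_of \<mu>))"
proof -
  have "psubst g (monom_of \<mu>) = (\<Prod>i\<in>{1..n}. g i ^ lookup \<mu> i)"
    unfolding psubst_monom using assms(1)
    by (intro prod.mono_neutral_left) (auto simp: compositions_def in_keys_iff)
  moreover have "has_lead n (\<Sum>i\<in>{1..n}. single (\<pi> i) (lookup \<mu> i)) (\<Prod>i\<in>{1..n}. g i ^ lookup \<mu> i)"
    using assms(2) by (intro has_lead_prod has_lead_power)
  ultimately show ?thesis by simp
qed

lemma psubst_deg_lt: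
  assumes "p \<in> deg_lt n d" "\<And>i. i \<in> {1..n} \<Longrightarrow> has_lead n (single (\<pi> i) 1) (g i)"
  shows "psubst g p \<in> deg_lt n d"
proof -
  have "psubst g p = (\<Sum>m\<in>keys p. Const (lookup p m) * psubst g (monom_of m))"
    by (subst monom_sum[of p]) (simp add: psubst_simps)
  moreover have "psubst g (monom_of m) \<in> deg_lt n d" if m: "m \<in> keys p" for m
  proof -
    have mc: "m \<in> compositions n" "weight m < d"
      using m assms(1) by (auto simp: deg_lt_def polys_def)
    have "psubst g (monom_of m) \<in> deg_lt n (Suc (\<Sum>i\<in>{1..n}. lookup m i))"
      using has_lead_deg_lt[OF psubst_has_lead_monom[OF mc(1) assms(2)]] by (simp add: weight_sum)
    then show ?thesis
      using mc weight_comp[of m n] by (auto intro: deg_lt_mono)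
  qed
  ultimately show ?thesis
    by (auto intro: deg_lt_sum deg_lt_Const_mult)
qed

text \<open>Each variable is replaced by a variable plus a constant, so the top component only has
  its variables renamed. This covers both the swap s_i and the affine rotation inside
  \<open>Phi_plus\<close>.\<close>

lemma psubst_has_lead:
  assumes "has_lead n \<mu> p" "\<And>i. i \<in> {1..n} \<Longrightarrow> has_lead n (single (\<pi> i) 1) (g i)"
  shows "has_lead n (\<Sum>i\<in>{1..n}. single (\<pi> i) (lookup \<mu> i)) (psubst g p)"
proof -
  let ?\<nu> = "\<Sum>i\<in>{1..n}. single (\<pi> i) (lookup \<mu> i)"
  have mu: "\<mu> \<in> compositions n" using assms(1) by (simp add: has_lead_def)
  have "psubst g (p - monom_of \<mu>) \<in> deg_lt n (weight \<mu>)"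
    using assms by (intro psubst_deg_lt[where \<pi> = \<pi>]) (auto simp: has_lead_def)
  moreover have "weight ?\<nu> = weight \<mu>"
    using mu by (simp add: weight_sum weight_comp)
  ultimately have "has_lead n ?\<nu> (psubst g (monom_of \<mu>) + psubst g (p - monom_of \<mu>))"
    using psubst_has_lead_monom[OF mu assms(2)] by (intro has_lead_add) auto
  then show ?thesis
    by (simp add: psubst_simps)
qed

section \<open>Reflection in the origin\<close>

definition neg :: "mpoly \<Rightarrow> mpoly" where "neg = psubst (\<lambda>i. - Var i)"

text \<open>Each monomial is an eigenvector of the reflection, with eigenvalue given by the parity
  of its degree; hence \<open>neg\<close> is an involution that preserves degree bounds.\<close>

lemma lookup_neg: "lookup (neg p) m = (- 1) ^ weight m * lookup p m"
proof -
  have "psubst (\<lambda>i. - Var i) (monom_of m) = Const ((- 1) ^ weight m) * monom_of m" for m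
  proof -
    have v: "(\<Prod>i\<in>keys m. Var i ^ lookup m i) = monom_of m"
      by (rule monom_prod[symmetric])
    have c: "Const ((- 1) ^ k) = (- 1) ^ k" for k :: nat
      by (induction k) (simp_all add: Const_mult Const_uminus)
    have "psubst (\<lambda>i. - Var i) (monom_of m) = (\<Prod>i\<in>keys m. (- 1) ^ lookup m i * Var i ^ lookup m i)"
      unfolding psubst_monom by (intro prod.cong refl power_minus)
    then show ?thesis
      by (simp only: prod.distrib v weight_def power_sum[symmetric] c)
  qed
  then have "neg p = (\<Sum>k\<in>keys p. Const (lookup p k) * (Const ((- 1) ^ weight k) * monom_of k))"
    unfolding neg_def by (subst monom_sum[of p]) (simp add: psubst_simps)
  then have "lookup (neg p) m = (\<Sum>k\<in>keys p. lookup p k * ((- 1) ^ weight k * lookup (monom_of k) m))"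
    by (simp only: lookup_sum lookup_Const_mult)
  then have "lookup (neg p) m = (\<Sum>k\<in>keys p. if k = m then (- 1) ^ weight m * lookup p m else 0)"
    by (simp add: monom_of_def lookup_single when_def if_distrib mult.commute cong: if_cong)
  then show ?thesis
    by (auto simp: in_keys_iff)
qed

lemma neg_neg [simp]: "neg (neg p) = p"
  by (rule poly_mapping_eqI) (simp add: lookup_neg flip: mult.assoc power_add)

lemma peval_neg: "peval v (neg p) = peval (\<lambda>i. - v i) p"
  by (simp add: neg_def peval_psubst peval_simps)

lemma neg_deg_lt: "p \<in> deg_lt n d \<Longrightarrow> neg p \<in> deg_lt n d"
  by (simp add: deg_lt_iff lookup_neg)


declare One_nat_def [simp del]

section \<open>Sorting permutations, the interpolation points, and their behaviour under the
  generators\<close>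

section \<open>The rank function and the interpolation points\<close>

text \<open>The order in which a stable sort into a decreasing sequence lists the positions: larger
  entries first, ties from left to right. The tie rule is what makes the sorting permutation
  shortest.\<close>

definition before :: "expo \<Rightarrow> nat \<Rightarrow> nat \<Rightarrow> bool" where
  "before \<gamma> a i \<longleftrightarrow> lookup \<gamma> i < lookup \<gamma> a \<or> (lookup \<gamma> a = lookup \<gamma> i \<and> a < i)"

definition predecessors :: "nat \<Rightarrow> expo \<Rightarrow> nat \<Rightarrow> nat set" where
  "predecessors n \<gamma> i = {a \<in> {1..n}. before \<gamma> a i}"

text \<open>The place of position \<open>i\<close> in the sorted sequence, counted from 1. Outside
  {1..n} it is the identity, as \<open>permutes\<close> demands.\<close>

definition rank :: "nat \<Rightarrow> expo \<Rightarrow> nat \<Rightarrow> nat" where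
  "rank n \<gamma> i = (if i \<in> {1..n} then Suc (card (predecessors n \<gamma> i)) else i)"

lemma finite_predecessors [simp]: "finite (predecessors n \<gamma> i)"
  by (simp add: predecessors_def)

lemma rank_less:
  assumes "a \<in> {1..n}" "i \<in> {1..n}" "before \<gamma> a i"
  shows "rank n \<gamma> a < rank n \<gamma> i"
proof -
  have "predecessors n \<gamma> a \<subset> predecessors n \<gamma> i"
    using assms by (auto simp: predecessors_def before_def)
  then have "card (predecessors n \<gamma> a) < card (predecessors n \<gamma> i)"
    by (intro psubset_card_mono) auto
  then show ?thesis
    using assms by (simp add: rank_def)
qed

lemma before_total: "a \<noteq> i \<Longrightarrow> before \<gamma> a i \<or> before \<gamma> i a"
  by (auto simp: before_def)

lemma rank_less_iff:
  assumes "a \<in> {1..n}" "i \<in> {1..n}"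
  shows "rank n \<gamma> a < rank n \<gamma> i \<longleftrightarrow> before \<gamma> a i"
  using rank_less[of a n i \<gamma>] rank_less[of i n a \<gamma>] before_total[of a i \<gamma>] assms
  by (metis less_asym less_irrefl)

lemma rank_range: "i \<in> {1..n} \<Longrightarrow> rank n \<gamma> i \<in> {1..n}"
proof -
  assume i: "i \<in> {1..n}"
  have "predecessors n \<gamma> i \<subseteq> {1..n} - {i}"
    by (auto simp: predecessors_def before_def)
  then have "card (predecessors n \<gamma> i) \<le> card ({1..n} - {i})"
    by (intro card_mono) auto
  then show ?thesis
    using i by (auto simp: rank_def)
qed

lemma rank_permutes: "rank n \<gamma> permutes {1..n}"
proof (rule bij_imp_permutes)
  have "inj_on (rank n \<gamma>) {1..n}"
    by (rule inj_onI) (metis before_total less_irrefl rank_less)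
  then show "bij_betw (rank n \<gamma>) {1..n} {1..n}"
    unfolding bij_betw_def using rank_range
    by (meson endo_inj_surj finite_atLeastAtMost image_subsetI)
qed (auto simp: rank_def)

definition sorts :: "nat \<Rightarrow> expo \<Rightarrow> (nat \<Rightarrow> nat) \<Rightarrow> bool" where
  "sorts n \<gamma> w \<longleftrightarrow> w permutes {1..n} \<and> weakly_decreasing n (perm_act (inv w) (lookup \<gamma>))"

text \<open>Rephrased through \<open>inv w\<close>, which sends a position of \<gamma> to its place
  in the sorted sequence and so can be compared with \<open>rank\<close>.\<close>

lemma weakly_decreasing_iff:
  assumes w: "w permutes {1..n}"
  shows "weakly_decreasing n (perm_act (inv w) (lookup \<gamma>)) \<longleftrightarrow>
    (\<forall>a\<in>{1..n}. \<forall>b\<in>{1..n}. lookup \<gamma> a < lookup \<gamma> b \<longrightarrow> inv w b < inv w a)"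
proof -
  have [simp]: "inv (inv w) = w"
    using permutes_inv_inv[OF w] .
  have "(\<forall>i j. 1 \<le> i \<and> i \<le> j \<and> j \<le> n \<longrightarrow> lookup \<gamma> (w j) \<le> lookup \<gamma> (w i)) \<longleftrightarrow>
    (\<forall>a\<in>{1..n}. \<forall>b\<in>{1..n}. lookup \<gamma> a < lookup \<gamma> b \<longrightarrow> inv w b < inv w a)" (is "?L \<longleftrightarrow> ?R")
  proof
    assume L: ?L
    show ?R
    proof (intro ballI impI)
      fix a b assume "a \<in> {1..n}" "b \<in> {1..n}" "lookup \<gamma> a < lookup \<gamma> b"
      moreover from this have "inv w a \<in> {1..n}" "inv w b \<in> {1..n}"
        using permutes_in_image[OF permutes_inv[OF w]] by auto
      ultimately show "inv w b < inv w a"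
        using L[rule_format, of "inv w a" "inv w b"] permutes_inverses(1)[OF w]
        by (metis atLeastAtMost_iff leD not_le)
    qed
  next
    assume R: ?R
    show ?L
    proof (intro allI impI)
      fix i j assume ij: "1 \<le> i \<and> i \<le> j \<and> j \<le> n"
      then have "w i \<in> {1..n}" "w j \<in> {1..n}"
        using permutes_in_image[OF w] by auto
      then show "lookup \<gamma> (w j) \<le> lookup \<gamma> (w i)"
        using R ij permutes_inverses(2)[OF w] by (metis leD not_le)
    qed
  qed
  then show ?thesis
    by (simp add: weakly_decreasing_def perm_act_def)
qed

text \<open>These are the inversions of \<open>inv w\<close>, equal in number to those of
  \<open>w\<close>. Their pairs are positions of \<gamma>, so they can be compared with
  \<open>ascents\<close>.\<close>

definition inversions :: "nat \<Rightarrow> (nat \<Rightarrow> nat) \<Rightarrow> (nat \<times> nat) set" where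
  "inversions n w = {(a, b). a \<in> {1..n} \<and> b \<in> {1..n} \<and> a < b \<and> inv w b < inv w a}"

definition ascents :: "nat \<Rightarrow> expo \<Rightarrow> (nat \<times> nat) set" where
  "ascents n \<gamma> = {(a, b). a \<in> {1..n} \<and> b \<in> {1..n} \<and> a < b \<and> lookup \<gamma> a < lookup \<gamma> b}"

lemma finite_inversions [simp]: "finite (inversions n w)"
  by (rule finite_subset[of _ "{1..n} \<times> {1..n}"]) (auto simp: inversions_def)

lemma perm_length_inversions:
  assumes w: "w permutes {1..n}"
  shows "perm_length n w = card (inversions n w)"
  unfolding perm_length_def
proof (rule bij_betw_same_card)
  show "bij_betw (\<lambda>(i, j). (w j, w i)) {(i, j). 1 \<le> i \<and> i < j \<and> j \<le> n \<and> w j < w i} (inversions n w)"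
  proof (rule bij_betwI[where g = "\<lambda>(a, b). (inv w b, inv w a)"])
    show "(\<lambda>(i, j). (w j, w i)) \<in> {(i, j). 1 \<le> i \<and> i < j \<and> j \<le> n \<and> w j < w i} \<rightarrow> inversions n w"
      using permutes_in_image[OF w] permutes_inverses(2)[OF w]
      by (fastforce simp: inversions_def)
    show "(\<lambda>(a, b). (inv w b, inv w a)) \<in> inversions n w \<rightarrow> {(i, j). 1 \<le> i \<and> i < j \<and> j \<le> n \<and> w j < w i}"
      using permutes_in_image[OF permutes_inv[OF w]] permutes_inverses(1)[OF w]
      by (force simp: inversions_def)
  qed (auto simp: permutes_inverses[OF w])
qed

lemma ascents_subset_inversions: "sorts n \<gamma> w \<Longrightarrow> ascents n \<gamma> \<subseteq> inversions n w"
  by (auto simp: sorts_def ascents_def inversions_def weakly_decreasing_iff)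

lemma sorts_rank: "sorts n \<gamma> (inv (rank n \<gamma>))"
proof -
  have "rank n \<gamma> permutes {1..n}" by (rule rank_permutes)
  then have "inv (rank n \<gamma>) permutes {1..n}" "inv (inv (rank n \<gamma>)) = rank n \<gamma>"
    by (simp_all add: permutes_inv permutes_inv_inv)
  then show ?thesis
    using weakly_decreasing_iff[of "inv (rank n \<gamma>)" n \<gamma>]
    by (simp add: sorts_def rank_less_iff before_def)
qed

text \<open>Ties are listed from left to right, so equal entries contribute no inversion and only
  the unavoidable ones remain.\<close>

lemma inversions_rank: "inversions n (inv (rank n \<gamma>)) = ascents n \<gamma>"
proof -
  have "inv (inv (rank n \<gamma>)) = rank n \<gamma>"
    using rank_permutes[of n \<gamma>] by (simp add: permutes_inv_inv)
  then show ?thesis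
    by (auto simp: inversions_def ascents_def rank_less_iff before_def)
qed

text \<open>The values below p(i) are exactly 1, ..., p(i) - 1 and all are attained. Thus a
  permutation can be recovered from the pairwise comparisons of its values.\<close>

lemma card_permutes_below:
  assumes "p permutes {1..n}" "i \<in> {1..n}"
  shows "p i = Suc (card {a \<in> {1..n}. p a < p i})"
proof -
  have "p ` {a \<in> {1..n}. p a < p i} = {1..<p i}"
  proof (intro equalityI subsetI)
    fix x assume "x \<in> {1..<p i}"
    moreover have "p i \<in> {1..n}"
      using assms permutes_in_image by metis
    ultimately have "x \<in> {1..n}" "x < p i" by auto
    then show "x \<in> p ` {a \<in> {1..n}. p a < p i}"
      using permutes_image[OF assms(1)] by (smt (verit) image_iff mem_Collect_eq)
  next
    fix x assume "x \<in> p ` {a \<in> {1..n}. p a < p i}"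
    then show "x \<in> {1..<p i}"
      using permutes_in_image[OF assms(1)] by fastforce
  qed
  moreover have "inj_on p A" for A
    using permutes_inj_on[OF assms(1)] .
  ultimately have "card {a \<in> {1..n}. p a < p i} = card {1..<p i}"
    by (metis card_image)
  moreover have "p i \<ge> 1"
    using assms permutes_in_image by (metis atLeastAtMost_iff)
  ultimately show ?thesis by simp
qed

text \<open>The inversion set decides every comparison between two values of \<open>inv w\<close>,
  and the comparisons decide the values by \<open>card_permutes_below\<close>.\<close>

lemma inv_eq_rank:
  assumes "sorts n \<gamma> w" "inversions n w = ascents n \<gamma>"
  shows "inv w = rank n \<gamma>"
proof
  fix i
  have w: "w permutes {1..n}" using assms(1) by (simp add: sorts_def)
  then have w': "inv w permutes {1..n}" by (rule permutes_inv)
  show "inv w i = rank n \<gamma> i"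
  proof (cases "i \<in> {1..n}")
    case True
    have "inv w a < inv w i \<longleftrightarrow> before \<gamma> a i" if a: "a \<in> {1..n}" for a
    proof (cases a i rule: linorder_cases)
      case less
      have "inv w a \<noteq> inv w i"
        using less permutes_inj[OF w'] by (auto dest: injD)
      then have "inv w a < inv w i \<longleftrightarrow> (a, i) \<notin> inversions n w"
        using less a True by (auto simp: inversions_def)
      also have "\<dots> \<longleftrightarrow> before \<gamma> a i"
        unfolding assms(2) using less a True by (auto simp: ascents_def before_def)
      finally show ?thesis .
    next
      case greater
      then have "inv w a < inv w i \<longleftrightarrow> (i, a) \<in> inversions n w"
        using a True by (auto simp: inversions_def)
      also have "\<dots> \<longleftrightarrow> before \<gamma> a i"
        unfolding assms(2) using greater a True by (auto simp: ascents_def before_def)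
      finally show ?thesis .
    qed (simp add: before_def)
    then have "{a \<in> {1..n}. inv w a < inv w i} = predecessors n \<gamma> i"
      by (auto simp: predecessors_def)
    then show ?thesis
      using card_permutes_below[OF w' True] True by (simp add: rank_def)
  next
    case False
    then show ?thesis
      using permutes_not_in[OF w'] by (auto simp: rank_def)
  qed
qed

text \<open>Every sorting permutation inverts at least the ascents of \<open>\<gamma>\<close>; the inverse of the rank
  function inverts nothing else, and a permutation is determined by its inversions.\<close>

lemma min_perm_eq: "min_perm n \<gamma> = inv (rank n \<gamma>)"
  unfolding min_perm_def sorts_def[symmetric]
proof (rule the_equality)
  have len: "perm_length n w = card (inversions n w)" if "sorts n \<gamma> w" for w
    using that perm_length_inversions by (simp add: sorts_def)
  have le: "card (ascents n \<gamma>) \<le> perm_length n w" if "sorts n \<gamma> w" for w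
    using ascents_subset_inversions[OF that] len[OF that] by (simp add: card_mono)
  have min: "perm_length n (inv (rank n \<gamma>)) = card (ascents n \<gamma>)"
    by (simp add: len sorts_rank inversions_rank)
  show "is_arg_min (perm_length n) (sorts n \<gamma>) (inv (rank n \<gamma>))"
    using le by (auto simp: is_arg_min_def sorts_rank min not_less)
  fix w assume "is_arg_min (perm_length n) (sorts n \<gamma>) w"
  then have s: "sorts n \<gamma> w" and "perm_length n w \<le> card (ascents n \<gamma>)"
    using sorts_rank[of n \<gamma>] by (auto simp: is_arg_min_def min not_less)
  then have "inversions n w = ascents n \<gamma>"
    using card_seteq[OF finite_inversions ascents_subset_inversions[OF s]] len[OF s] by simp
  then have "inv w = rank n \<gamma>"
    by (rule inv_eq_rank[OF s])
  then show "w = inv (rank n \<gamma>)"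
    using s permutes_inv_inv[of w "{1..n}"] by (simp add: sorts_def)
qed

lemma point_eq: "point n \<gamma> i = of_nat (lookup \<gamma> i) + r * of_nat (n - rank n \<gamma> i)"
  using permutes_inv_inv[OF rank_permutes[of n \<gamma>]]
  by (simp add: point_def min_perm_eq perm_act_def delta_def)

lemma r_to_fract: "r = to_fract [:0, 1:]"
  by (simp add: r_def to_fract_def)

lemma of_nat_to_fract: "of_nat k = to_fract (of_nat k :: 'a::idom)"
  by (induction k) simp_all

text \<open>Each coordinate is a polynomial in r with constant term the entry of \<gamma>. Setting r
  = 0 therefore turns the point into the composition itself.\<close>

lemma point_to_fract:
  "point n \<gamma> i = to_fract [: of_nat (lookup \<gamma> i), of_nat (n - rank n \<gamma> i) :]"
proof -
  have "[: rat_of_nat (lookup \<gamma> i), of_nat (n - rank n \<gamma> i) :]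
    = of_nat (lookup \<gamma> i) + [:0, 1:] * of_nat (n - rank n \<gamma> i)"
    by (simp add: of_nat_poly)
  then show ?thesis
    unfolding point_eq r_to_fract by (simp only: of_nat_to_fract[where 'a = "rat poly"] to_fract_add to_fract_mult)
qed

text \<open>Distinct positions have distinct ranks, so already the coefficients of r differ. This
  permits cancelling x_i - x_(i+1) after evaluation at a point.\<close>

lemma point_inj:
  assumes "i \<in> {1..n}" "j \<in> {1..n}" "i \<noteq> j"
  shows "point n \<gamma> i \<noteq> point n \<gamma> j"
proof -
  have "rank n \<gamma> i \<noteq> rank n \<gamma> j"
    using assms permutes_inj[OF rank_permutes[of n \<gamma>]] by (auto dest: injD)
  moreover have "rank n \<gamma> i \<le> n" "rank n \<gamma> j \<le> n"
    using assms rank_range[of _ n \<gamma>] by auto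
  ultimately show ?thesis
    by (auto simp: point_to_fract)
qed

section \<open>Compositions under the generators\<close>

lemma swap_comp_comp:
  assumes "\<eta> \<in> compositions n" "1 \<le> i" "i \<le> n - 1"
  shows "swap_comp i \<eta> \<in> compositions n"
proof -
  have "j \<in> {1..n}" if "lookup (swap_comp i \<eta>) j \<noteq> 0" for j
  proof -
    have "transpose i (Suc i) j \<in> {1..n}"
      using that comp_lookup_0[OF assms(1)] by (metis lookup_swap_comp)
    then show ?thesis
      using assms by (auto simp: transpose_def split: if_splits)
  qed
  then show ?thesis
    by (auto simp: compositions_def in_keys_iff simp del: atLeastAtMost_iff)
qed

lemma lookup_Phi_last: "lookup (Phi n \<eta>) n = Suc (lookup \<eta> 1)"
  by (simp add: lookup_Phi)

lemma lookup_Phi_less: "1 \<le> j \<Longrightarrow> j < n \<Longrightarrow> lookup (Phi n \<eta>) j = lookup \<eta> (Suc j)"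
  by (simp add: lookup_Phi Suc_eq_plus1)

lemma transpose_range: "1 \<le> i \<Longrightarrow> i \<le> n - 1 \<Longrightarrow> transpose i (Suc i) j \<in> {1..n} \<longleftrightarrow> j \<in> {1..n}"
  by (auto simp: transpose_def)

lemma weight_swap:
  assumes "\<eta> \<in> compositions n" "1 \<le> i" "i \<le> n - 1"
  shows "weight (swap_comp i \<eta>) = weight \<eta>"
proof -
  have "(\<Sum>j\<in>{1..n}. lookup (swap_comp i \<eta>) j) = (\<Sum>j\<in>{1..n}. lookup \<eta> j)"
    by (rule sum.reindex_bij_witness[of _ "transpose i (Suc i)" "transpose i (Suc i)"])
      (use assms in \<open>auto simp: lookup_swap_comp transpose_range simp del: atLeastAtMost_iff\<close>)
  then show ?thesis
    using weight_comp[OF assms(1)] weight_comp[OF swap_comp_comp[OF assms]] by simp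
qed

lemma Phi_comp: "\<eta> \<in> compositions n \<Longrightarrow> n \<ge> 1 \<Longrightarrow> Phi n \<eta> \<in> compositions n"
  by (auto simp: compositions_def in_keys_iff lookup_Phi split: if_splits)

lemma weight_Phi:
  assumes "\<eta> \<in> compositions n" "n \<ge> 1"
  shows "weight (Phi n \<eta>) = Suc (weight \<eta>)"
proof -
  obtain m where n: "n = Suc m" using assms(2) by (cases n) auto
  have "(\<Sum>j\<in>{1..n}. lookup (Phi n \<eta>) j) = (\<Sum>j\<in>{1..m}. lookup \<eta> (Suc j)) + lookup \<eta> 1 + 1"
    unfolding n by (simp add: lookup_Phi_less lookup_Phi_last)
  also have "(\<Sum>j\<in>{1..m}. lookup \<eta> (Suc j)) + lookup \<eta> 1 = (\<Sum>j\<in>{1..n}. lookup \<eta> j)"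
    unfolding n by (subst sum.atLeast_Suc_atMost[of 1 "Suc m"], simp, subst sum.shift_bounds_cl_Suc_ivl, simp)
  finally show ?thesis
    using weight_comp[OF assms(1)] weight_comp[OF Phi_comp[OF assms]] by simp
qed

lemma Phi_surj:
  assumes "\<gamma> \<in> compositions n" "n \<ge> 1" "lookup \<gamma> n \<noteq> 0"
  shows "\<exists>\<gamma>'\<in>compositions n. \<gamma> = Phi n \<gamma>'"
proof -
  \<comment> \<open>The inverse rotation. The natural-number subtraction is exact because the last
    entry of \<gamma> is nonzero.\<close>
  define f where "f = (\<lambda>i. if i = 1 then lookup \<gamma> n - 1 else if 1 < i \<and> i \<le> n then lookup \<gamma> (i - 1) else 0)"
  have fin: "finite {i. f i \<noteq> 0}"
    by (rule finite_subset[of _ "{..max 1 n}"]) (auto simp: f_def split: if_splits)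
  have l: "lookup (Abs_poly_mapping f) = f"
    by (rule lookup_Abs_poly_mapping[OF fin])
  have c: "Abs_poly_mapping f \<in> compositions n"
    unfolding compositions_def mem_Collect_eq subset_iff in_keys_iff l
    using assms(2) by (auto simp: f_def split: if_splits)
  have "\<gamma> = Phi n (Abs_poly_mapping f)"
    by (rule comp_eqI[OF assms(1) Phi_comp[OF c assms(2)]])
      (use assms in \<open>auto simp: lookup_Phi l, auto simp: f_def\<close>)
  with c show ?thesis by blast
qed

text \<open>Positions i and i + 1 lie on the same side of every other position, so the swap can only
  disturb a tie between these two, and unequal entries exclude it. Hence the sorting order is
  carried along by the swap.\<close>

lemma point_swap:
  assumes "\<gamma> \<in> compositions n" "1 \<le> i" "i \<le> n - 1" "lookup \<gamma> i \<noteq> lookup \<gamma> (Suc i)" "j \<in> {1..n}"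
  shows "point n (swap_comp i \<gamma>) j = point n \<gamma> (transpose i (Suc i) j)"
proof -
  let ?s = "transpose i (Suc i)"
  have "before (swap_comp i \<gamma>) a j \<longleftrightarrow> before \<gamma> (?s a) (?s j)" for a
    using assms(4) by (auto simp: before_def lookup_swap_comp transpose_def)
  then have "bij_betw ?s (predecessors n (swap_comp i \<gamma>) j) (predecessors n \<gamma> (?s j))"
    by (intro bij_betwI[where g = ?s])
      (use assms transpose_range[OF assms(2,3)] in \<open>auto simp: predecessors_def simp del: atLeastAtMost_iff One_nat_def\<close>)
  then have "card (predecessors n (swap_comp i \<gamma>) j) = card (predecessors n \<gamma> (?s j))"
    by (rule bij_betw_same_card)
  then have "rank n (swap_comp i \<gamma>) j = rank n \<gamma> (?s j)"
    using assms(5) transpose_range[OF assms(2,3)] by (simp add: rank_def del: atLeastAtMost_iff)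
  then show ?thesis
    by (simp add: point_eq lookup_swap_comp)
qed

text \<open>By the tie rule, i and i + 1 are consecutive in the sorting order, so their ranks differ
  by one. The resulting gap r is the constant in \<open>sigma_plus\<close>.\<close>

lemma point_equal_entries:
  assumes "1 \<le> i" "i \<le> n - 1" "lookup \<gamma> i = lookup \<gamma> (Suc i)"
  shows "point n \<gamma> i - point n \<gamma> (Suc i) = r"
proof -
  have "predecessors n \<gamma> (Suc i) = insert i (predecessors n \<gamma> i)"
    using assms by (auto simp: predecessors_def before_def)
  moreover have "i \<notin> predecessors n \<gamma> i"
    by (simp add: predecessors_def before_def)
  ultimately have *: "rank n \<gamma> (Suc i) = Suc (rank n \<gamma> i)"
    using assms by (auto simp: rank_def)
  moreover have "rank n \<gamma> (Suc i) \<le> n"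
    using rank_range[of "Suc i" n \<gamma>] assms by auto
  ultimately have "n - rank n \<gamma> i = Suc (n - rank n \<gamma> (Suc i))"
    by simp
  then show ?thesis
    using assms(3) by (simp add: point_eq algebra_simps)
qed

text \<open>A zero in the last position comes last in the sorting order: it has rank n, and both
  summands of the coordinate vanish.\<close>

lemma point_last_zero:
  assumes "n \<ge> 1" "lookup \<gamma> n = 0"
  shows "point n \<gamma> n = 0"
proof -
  have "predecessors n \<gamma> n = {1..<n}"
    using assms by (auto simp: predecessors_def before_def order_le_less)
  then show ?thesis
    using assms by (simp add: point_eq rank_def)
qed

text \<open>Phi preserves the sorting order. An entry tied with the first one used to come after it
  and is now strictly smaller; an entry larger by one used to come before it and now wins the tie,
  standing further left.\<close>

lemma point_Phi_last:
  assumes "n \<ge> 1"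
  shows "point n (Phi n \<gamma>) n = point n \<gamma> 1 + 1"
proof -
  have before: "before (Phi n \<gamma>) a n \<longleftrightarrow> before \<gamma> (Suc a) 1" if "1 \<le> a" "a < n" for a
    using that by (auto simp: before_def lookup_Phi_last lookup_Phi_less)
  have "predecessors n \<gamma> 1 = Suc ` predecessors n (Phi n \<gamma>) n"
  proof (intro equalityI subsetI)
    fix b assume b: "b \<in> predecessors n \<gamma> 1"
    then have "b \<noteq> 0" "b \<noteq> 1"
      by (auto simp: predecessors_def before_def)
    then obtain a where "b = Suc a" "1 \<le> a"
      by (cases b) auto
    with b before[of a] show "b \<in> Suc ` predecessors n (Phi n \<gamma>) n"
      by (auto simp: predecessors_def)
  next
    fix b assume "b \<in> Suc ` predecessors n (Phi n \<gamma>) n"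
    then obtain a where a: "b = Suc a" "1 \<le> a" "a \<le> n" "before (Phi n \<gamma>) a n"
      by (auto simp: predecessors_def)
    then have "a < n"
      by (cases "a = n") (auto simp: before_def)
    with a before[of a] show "b \<in> predecessors n \<gamma> 1"
      by (auto simp: predecessors_def)
  qed
  then have "card (predecessors n \<gamma> 1) = card (predecessors n (Phi n \<gamma>) n)"
    by (simp add: card_image)
  then have "rank n (Phi n \<gamma>) n = rank n \<gamma> 1"
    using assms by (simp add: rank_def)
  then show ?thesis
    by (simp add: point_eq lookup_Phi)
qed

lemma point_Phi:
  assumes "1 \<le> j" "j < n"
  shows "point n (Phi n \<gamma>) j = point n \<gamma> (Suc j)"
proof -
  \<comment> \<open>\<open>?f a\<close> is the position in \<gamma> from which entry
    \<open>a\<close> of \<open>Phi n \<gamma>\<close> was taken.\<close>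
  let ?f = "\<lambda>a. if a = n then 1 else Suc a"
  have before: "before (Phi n \<gamma>) a j \<longleftrightarrow> before \<gamma> (?f a) (Suc j)" if "1 \<le> a" "a \<le> n" for a
  proof (cases "a = n")
    case True
    then show ?thesis
      using assms by (auto simp: before_def lookup_Phi_last lookup_Phi_less less_Suc_eq)
  next
    case False
    then show ?thesis
      using assms that by (auto simp: before_def lookup_Phi_less)
  qed
  have "predecessors n \<gamma> (Suc j) = ?f ` predecessors n (Phi n \<gamma>) j"
  proof (intro equalityI subsetI)
    fix b assume b: "b \<in> predecessors n \<gamma> (Suc j)"
    define a where "a = (if b = 1 then n else b - 1)"
    have "1 \<le> a" "a \<le> n" "b = ?f a"
      using b assms by (auto simp: predecessors_def a_def)
    with b before[of a] show "b \<in> ?f ` predecessors n (Phi n \<gamma>) j"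
      by (auto simp: predecessors_def)
  next
    fix b assume "b \<in> ?f ` predecessors n (Phi n \<gamma>) j"
    then obtain a where "b = ?f a" "1 \<le> a" "a \<le> n" "before (Phi n \<gamma>) a j"
      by (force simp: predecessors_def)
    with before[of a] show "b \<in> predecessors n \<gamma> (Suc j)"
      by (auto simp: predecessors_def)
  qed
  moreover have "inj_on ?f (predecessors n (Phi n \<gamma>) j)"
    by (rule inj_onI) (auto simp: predecessors_def split: if_splits)
  ultimately have "card (predecessors n \<gamma> (Suc j)) = card (predecessors n (Phi n \<gamma>) j)"
    by (simp only: card_image)
  then have "rank n (Phi n \<gamma>) j = rank n \<gamma> (Suc j)"
    using assms by (simp add: rank_def)
  then show ?thesis
    using assms by (simp add: point_eq lookup_Phi_less)
qed


section \<open>Linear algebra and unisolvence of the interpolation points\<close>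

section \<open>Square linear systems\<close>

text \<open>Gaussian elimination, by induction on the equations: an equation with a nonzero
  coefficient is solved for one unknown, and the result is substituted into the others.\<close>

lemma nontrivial_solution:
  fixes A :: "'i \<Rightarrow> 'j \<Rightarrow> 'a::field"
  assumes "finite I" "finite J" "card I < card J"
  shows "\<exists>c. (\<exists>j\<in>J. c j \<noteq> 0) \<and> (\<forall>i\<in>I. (\<Sum>j\<in>J. A i j * c j) = 0)"
  using assms
proof (induction I arbitrary: J A rule: finite_induct)
  case empty
  then have "J \<noteq> {}" by auto
  then show ?case
    by (intro exI[of _ "\<lambda>_. 1"]) auto
next
  case (insert i I)
  show ?case
  proof (cases "\<forall>j\<in>J. A i j = 0")
    case True
    then show ?thesis
      using insert.IH[of J A] insert.prems insert.hyps by auto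
  next
    case False
    then obtain j0 where j0: "j0 \<in> J" "A i j0 \<noteq> 0" by blast
    have "card I < card (J - {j0})"
      using insert.prems insert.hyps j0 by simp
    then obtain c' j1 where c': "j1 \<in> J - {j0}" "c' j1 \<noteq> 0"
      "\<And>k. k \<in> I \<Longrightarrow> (\<Sum>j\<in>J - {j0}. (A k j - A k j0 * A i j / A i j0) * c' j) = 0"
      using insert.IH[of "J - {j0}" "\<lambda>k j. A k j - A k j0 * A i j / A i j0"] insert.prems by auto
    \<comment> \<open>The value at \<open>j0\<close> is the one that equation \<open>i\<close>
      forces once the other unknowns are fixed.\<close>
    define c where "c = c'(j0 := - (\<Sum>j\<in>J - {j0}. A i j * c' j) / A i j0)"
    have "(\<Sum>j\<in>J. A k j * c j) = (\<Sum>j\<in>J - {j0}. (A k j - A k j0 * A i j / A i j0) * c' j)" for k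
    proof -
      have "(\<Sum>j\<in>J. A k j * c j) = A k j0 * c j0 + (\<Sum>j\<in>J - {j0}. A k j * c j)"
        using insert.prems j0 by (simp add: sum.remove)
      also have "(\<Sum>j\<in>J - {j0}. A k j * c j) = (\<Sum>j\<in>J - {j0}. A k j * c' j)"
        by (rule sum.cong) (auto simp: c_def)
      also have "A k j0 * c j0 = - (\<Sum>j\<in>J - {j0}. A k j0 * A i j / A i j0 * c' j)"
        by (simp add: c_def sum_distrib_left sum_divide_distrib algebra_simps)
      finally show ?thesis
        by (simp add: left_diff_distrib sum_subtractf)
    qed
    moreover have "(\<Sum>j\<in>J - {j0}. (A i j - A i j0 * A i j / A i j0) * c' j) = 0"
      using j0 by simp
    ultimately have "\<forall>k\<in>insert i I. (\<Sum>j\<in>J. A k j * c j) = 0"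
      using c'(3) by auto
    moreover have "\<exists>j\<in>J. c j \<noteq> 0"
      using c'(1,2) by (auto simp: c_def)
    ultimately show ?thesis by blast
  qed
qed

text \<open>The right-hand side is added as one more column, with index \<open>None\<close>, so
  there are more unknowns than equations. By injectivity a nontrivial solution has a nonzero
  \<open>None\<close> coordinate, and dividing by it solves the system.\<close>

lemma square_system_solvable:
  fixes A :: "'i \<Rightarrow> 'i \<Rightarrow> 'a::field"
  assumes fin: "finite I"
    and inj: "\<And>c. (\<And>i. i \<in> I \<Longrightarrow> (\<Sum>j\<in>I. A i j * c j) = 0) \<Longrightarrow> \<forall>j\<in>I. c j = 0"
  shows "\<exists>c. \<forall>i\<in>I. (\<Sum>j\<in>I. A i j * c j) = b i"
proof -
  let ?J = "insert None (Some ` I)"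
  let ?A = "\<lambda>i j. case j of None \<Rightarrow> - b i | Some j \<Rightarrow> A i j"
  have "card I < card ?J"
    using fin by (simp add: card_image)
  then obtain c where c: "\<exists>j\<in>?J. c j \<noteq> 0" "\<And>i. i \<in> I \<Longrightarrow> (\<Sum>j\<in>?J. ?A i j * c j) = 0"
    using nontrivial_solution[of I ?J ?A] fin by auto
  have eq: "(\<Sum>j\<in>I. A i j * c (Some j)) = b i * c None" if "i \<in> I" for i
    using c(2)[OF that] fin by (simp add: sum.reindex)
  have "c None \<noteq> 0"
  proof
    assume "c None = 0"
    then have "\<forall>j\<in>I. c (Some j) = 0"
      using eq by (intro inj) simp
    with c(1) \<open>c None = 0\<close> show False by auto
  qed
  then have "\<forall>i\<in>I. (\<Sum>j\<in>I. A i j * (c (Some j) / c None)) = b i"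
    using eq by (simp add: sum_divide_distrib[symmetric])
  then show ?thesis
    by (intro exI[of _ "\<lambda>j. c (Some j) / c None"])
qed

lemma common_denominator:
  fixes c :: "'i \<Rightarrow> 'a::idom fract"
  assumes "finite I"
  shows "\<exists>D a. D \<noteq> 0 \<and> (\<forall>i\<in>I. to_fract D * c i = to_fract (a i))"
  using assms
proof (induction I rule: finite_induct)
  case empty
  show ?case by (rule exI[of _ 1]) simp
next
  case (insert i I)
  then obtain D a where D: "D \<noteq> 0" "\<forall>i\<in>I. to_fract D * c i = to_fract (a i)" by blast
  obtain x y where xy: "c i = Fract x y" "y \<noteq> 0" by (cases "c i")
  then have ci: "to_fract y * c i = to_fract x"
    by (simp add: Fract_conv_to_fract)
  let ?a = "(\<lambda>j. y * a j)(i := D * x)"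
  have "to_fract (D * y) * c j = to_fract (?a j)" if "j \<in> insert i I" for j
  proof (cases "j = i")
    case True
    then show ?thesis
      using ci by (simp add: mult.assoc)
  next
    case False
    then have "to_fract D * c j = to_fract (a j)"
      using that D by auto
    with False show ?thesis
      by (simp add: mult_ac)
  qed
  then show ?case
    using D(1) xy(2) by (intro exI[of _ "D * y"] exI[of _ ?a]) auto
qed

text \<open>If a system over \<open>\<rat>[r]\<close> is triangular with non-zero diagonal at \<open>r = 0\<close>, then every
  solution over \<open>\<rat>[r]\<close> vanishes at \<open>r = 0\<close>; dividing by \<open>r\<close> and repeating, it is divisible
  by all powers of \<open>r\<close>.\<close>

lemma specialised_system_injective:
  fixes A :: "'i \<Rightarrow> 'i \<Rightarrow> rat poly" and wt :: "'i \<Rightarrow> nat"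
  assumes fin: "finite I"
    and diag: "\<And>i. i \<in> I \<Longrightarrow> poly (A i i) 0 \<noteq> 0"
    and tri: "\<And>i j. i \<in> I \<Longrightarrow> j \<in> I \<Longrightarrow> i \<noteq> j \<Longrightarrow> wt i \<le> wt j \<Longrightarrow> poly (A i j) 0 = 0"
    and sys: "\<And>i. i \<in> I \<Longrightarrow> (\<Sum>j\<in>I. to_fract (A i j) * c j) = 0"
    and j: "j \<in> I"
  shows "c j = 0"
proof -
  obtain D a where D: "D \<noteq> 0" "\<And>i. i \<in> I \<Longrightarrow> to_fract D * c i = to_fract (a i)"
    using common_denominator[OF fin, of c] by blast
  have at_0: "\<forall>j\<in>I. poly (b j) 0 = 0" if b: "\<And>i. i \<in> I \<Longrightarrow> (\<Sum>j\<in>I. A i j * b j) = 0" for b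
  proof
    fix i assume "i \<in> I"
    then show "poly (b i) 0 = 0"
    proof (induction "wt i" arbitrary: i rule: less_induct)
      case less
      have "poly (\<Sum>j\<in>I. A i j * b j) 0 = 0"
        using b less.prems by simp
      then have "(\<Sum>j\<in>I. poly (A i j) 0 * poly (b j) 0) = 0"
        by (simp add: poly_sum)
      \<comment> \<open>Off the diagonal, a column of weight at least that of the row has
        coefficient 0 at r = 0, and a column of smaller weight has unknown 0 by induction. Only the
        diagonal term survives.\<close>
      moreover have "poly (A i j) 0 * poly (b j) 0 = 0" if "j \<in> I - {i}" for j
        using that less tri[of i j] by (cases "wt j < wt i") auto
      ultimately have "poly (A i i) 0 * poly (b i) 0 = 0"
        using fin less.prems by (simp add: sum.remove)
      then show ?case
        using diag less.prems by simp
    qed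
  qed
  have a: "(\<Sum>j\<in>I. A i j * a j) = 0" if "i \<in> I" for i
  proof -
    have "to_fract (\<Sum>j\<in>I. A i j * a j) = (\<Sum>j\<in>I. to_fract (A i j) * (to_fract D * c j))"
      using D(2) by simp
    also have "\<dots> = to_fract D * (\<Sum>j\<in>I. to_fract (A i j) * c j)"
      by (simp add: sum_distrib_left mult_ac)
    finally show ?thesis
      using sys[OF that] by (simp del: to_fract_sum)
  qed
  have "\<exists>b. \<forall>j\<in>I. a j = [:0, 1:] ^ k * b j" for k
  proof (induction k)
    case 0
    show ?case by (rule exI[of _ a]) simp
  next
    case (Suc k)
    then obtain b where b: "\<And>j. j \<in> I \<Longrightarrow> a j = [:0, 1:] ^ k * b j" by blast
    have "(\<Sum>j\<in>I. A i j * b j) = 0" if "i \<in> I" for i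
    proof -
      have "[:0, 1:] ^ k * (\<Sum>j\<in>I. A i j * b j) = (\<Sum>j\<in>I. A i j * a j)"
        using b by (simp add: sum_distrib_left mult_ac)
      then show ?thesis
        using a[OF that] by simp
    qed
    then have "\<forall>j\<in>I. poly (b j) 0 = 0"
      by (rule at_0)
    then have "\<forall>j\<in>I. \<exists>b'. b j = [:0, 1:] * b'"
      by (auto simp: poly_eq_0_iff_dvd dvd_def)
    then obtain b' where "\<forall>j\<in>I. b j = [:0, 1:] * b' j"
      by metis
    then show ?case
      using b by (intro exI[of _ b']) (auto simp: mult_ac)
  qed
  then have dvd: "[:0, 1:] ^ k dvd a j" for k
    using j by (metis dvd_triv_left)
  have "a j = 0"
  proof (rule ccontr)
    assume "a j \<noteq> 0"
    then have "degree ([:0, 1:] ^ Suc (degree (a j)) :: rat poly) \<le> degree (a j)"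
      using dvd by (intro dvd_imp_degree_le)
    then show False
      by (simp add: degree_power_eq)
  qed
  then show ?thesis
    using D j by (metis to_fract_eq_0_iff mult_eq_0_iff)
qed

section \<open>The falling factorial basis\<close>

definition comps_lt :: "nat \<Rightarrow> nat \<Rightarrow> expo set" where
  "comps_lt n d = {\<mu> \<in> compositions n. weight \<mu> < d}"

lemma finite_comps_lt [simp]: "finite (comps_lt n d)"
proof (rule inj_on_finite)
  show "inj_on (\<lambda>\<mu>. restrict (lookup \<mu>) {1..n}) (comps_lt n d)"
  proof (rule inj_onI)
    fix \<mu> \<nu> assume *: "\<mu> \<in> comps_lt n d" "\<nu> \<in> comps_lt n d"
      "restrict (lookup \<mu>) {1..n} = restrict (lookup \<nu>) {1..n}"
    then have "lookup \<mu> i = lookup \<nu> i" if "i \<in> {1..n}" for i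
      using that by (metis restrict_apply')
    with * show "\<mu> = \<nu>"
      by (intro comp_eqI[of \<mu> n \<nu>]) (auto simp: comps_lt_def)
  qed
  show "(\<lambda>\<mu>. restrict (lookup \<mu>) {1..n}) ` comps_lt n d \<subseteq> {1..n} \<rightarrow>\<^sub>E {..<d}"
  proof (intro image_subsetI restrict_PiE_iff[THEN iffD2] ballI)
    fix \<mu> i assume "\<mu> \<in> comps_lt n d" "i \<in> {1..n}"
    moreover have "lookup \<mu> i \<le> (\<Sum>i\<in>{1..n}. lookup \<mu> i)" if "i \<in> {1..n}"
      using that by (intro member_le_sum) auto
    ultimately show "lookup \<mu> i \<in> {..<d}"
      using weight_comp[of \<mu> n] by (auto simp: comps_lt_def)
  qed
qed (auto intro: finite_PiE)

text \<open>The product of the falling factorials x_i (x_i - 1) ... (x_i - mu_i + 1). At a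
  composition \<gamma> it is nonzero only if mu_i is at most gamma_i for all i, which is the source
  of triangularity.\<close>

definition falling :: "nat \<Rightarrow> expo \<Rightarrow> mpoly" where
  "falling n \<mu> = (\<Prod>i\<in>{1..n}. \<Prod>k<lookup \<mu> i. Var i - Const (of_nat k))"

lemma Const_deg_lt: "Const c \<in> deg_lt n 1"
  using deg_lt_Const_mult[OF deg_lt_monom[of 0 n 1], of c] by (simp add: monom_of_def)

lemma has_lead_Var_plus: "i \<in> {1..n} \<Longrightarrow> has_lead n (single i 1) (Var i + Const c)"
  using Const_deg_lt by (intro has_lead_add has_lead_Var) auto

lemma has_lead_falling:
  assumes "\<mu> \<in> compositions n"
  shows "has_lead n \<mu> (falling n \<mu>)"
proof -
  have lin: "has_lead n (single i 1) (Var i - Const c)" if "i \<in> {1..n}" for i c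
    using has_lead_Var_plus[OF that, of "- c"] by (simp add: Const_uminus)
  have "has_lead n (single i m) (\<Prod>k<m. Var i - Const (of_nat k))" if "i \<in> {1..n}" for i m
  proof (induction m)
    case (Suc m)
    then show ?case
      using has_lead_mult[OF Suc lin[OF that, of "of_nat m"]]
      by (simp flip: single_add Suc_eq_plus1)
  qed (simp add: has_lead_1)
  then have "has_lead n (\<Sum>i\<in>{1..n}. single i (lookup \<mu> i)) (falling n \<mu>)"
    unfolding falling_def by (intro has_lead_prod) auto
  moreover have "(\<Sum>i\<in>{1..n}. single i (lookup \<mu> i)) = \<mu>"
    using comp_lookup_0[OF assms]
    by (intro poly_mapping_eqI) (auto simp: lookup_sum lookup_single when_def)
  ultimately show ?thesis by simp
qed

lemma deg_lt_dest:
  assumes "p \<in> deg_lt n (Suc d)" "\<And>m. weight m = d \<Longrightarrow> lookup p m = 0"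
  shows "p \<in> deg_lt n d"
  using assms unfolding deg_lt_iff by (metis less_SucE)

text \<open>The top component of \<open>falling n \<mu>\<close> is x^mu, so subtracting with the
  coefficients of \<open>p\<close> removes its whole top component at once. The second conjunct lets
  top coefficients of \<open>p\<close> be read off in this basis.\<close>

lemma falling_basis:
  assumes "p \<in> deg_lt n d"
  shows "\<exists>c. p = (\<Sum>\<mu>\<in>comps_lt n d. Const (c \<mu>) * falling n \<mu>) \<and>
    (\<forall>\<mu>. Suc (weight \<mu>) = d \<longrightarrow> c \<mu> = lookup p \<mu>)"
  using assms
proof (induction d arbitrary: p)
  case 0
  then show ?case
    by (auto simp: comps_lt_def dest: deg_lt_0)
next
  case (Suc d)
  let ?T = "{\<mu> \<in> compositions n. weight \<mu> = d}"
  have un: "comps_lt n (Suc d) = comps_lt n d \<union> ?T"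
    by (auto simp: comps_lt_def)
  then have finT: "finite ?T"
    by (metis finite_Un finite_comps_lt)
  let ?q = "p - (\<Sum>\<mu>\<in>?T. Const (lookup p \<mu>) * falling n \<mu>)"
  have "?q \<in> deg_lt n (Suc d)"
    using Suc.prems has_lead_deg_lt[OF has_lead_falling]
    by (intro deg_lt_diff deg_lt_sum deg_lt_Const_mult) auto
  moreover have "lookup ?q m = 0" if m: "weight m = d" for m
  proof -
    have "lookup (\<Sum>\<mu>\<in>?T. Const (lookup p \<mu>) * falling n \<mu>) m
      = (\<Sum>\<mu>\<in>?T. if m = \<mu> then lookup p m else 0)"
      unfolding lookup_sum lookup_Const_mult
      using m has_lead_cases[OF has_lead_falling] by (intro sum.cong) auto
    also have "\<dots> = lookup p m"
      using Suc.prems m finT by (auto simp: deg_lt_iff)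
    finally show ?thesis
      by (simp add: lookup_minus)
  qed
  ultimately have "?q \<in> deg_lt n d"
    by (rule deg_lt_dest)
  then obtain c where c: "?q = (\<Sum>\<mu>\<in>comps_lt n d. Const (c \<mu>) * falling n \<mu>)"
    using Suc.IH by blast
  let ?c = "\<lambda>\<mu>. if weight \<mu> = d then lookup p \<mu> else c \<mu>"
  have "p = ?q + (\<Sum>\<mu>\<in>?T. Const (lookup p \<mu>) * falling n \<mu>)"
    by simp
  also have "?q = (\<Sum>\<mu>\<in>comps_lt n d. Const (?c \<mu>) * falling n \<mu>)"
    unfolding c by (rule sum.cong) (auto simp: comps_lt_def)
  also have "(\<Sum>\<mu>\<in>?T. Const (lookup p \<mu>) * falling n \<mu>) = (\<Sum>\<mu>\<in>?T. Const (?c \<mu>) * falling n \<mu>)"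
    by (rule sum.cong) auto
  also have "(\<Sum>\<mu>\<in>comps_lt n d. Const (?c \<mu>) * falling n \<mu>) + (\<Sum>\<mu>\<in>?T. Const (?c \<mu>) * falling n \<mu>)
    = (\<Sum>\<mu>\<in>comps_lt n (Suc d). Const (?c \<mu>) * falling n \<mu>)"
    unfolding un by (rule sum.union_disjoint[symmetric, OF finite_comps_lt finT]) (auto simp: comps_lt_def)
  finally have "p = (\<Sum>\<mu>\<in>comps_lt n (Suc d). Const (?c \<mu>) * falling n \<mu>)" .
  then show ?case
    by (intro exI[of _ ?c]) auto
qed

text \<open>The value of \<open>falling n \<mu>\<close> at \<open>point n \<gamma>\<close>, kept in
  Q[r] so that r can be set to 0.\<close>

definition falling_value :: "nat \<Rightarrow> expo \<Rightarrow> expo \<Rightarrow> rat poly" where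
  "falling_value n \<gamma> \<mu> = (\<Prod>i\<in>{1..n}. \<Prod>k<lookup \<mu> i.
    [: of_nat (lookup \<gamma> i) - of_nat k, of_nat (n - rank n \<gamma> i) :])"

lemma to_fract_prod: "to_fract (prod f A) = (\<Prod>a\<in>A. to_fract (f a))"
  by (induction A rule: infinite_finite_induct) auto

lemma peval_falling: "peval (point n \<gamma>) (falling n \<mu>) = to_fract (falling_value n \<gamma> \<mu>)"
proof -
  have "point n \<gamma> i - of_nat k = to_fract [: of_nat (lookup \<gamma> i) - of_nat k, of_nat (n - rank n \<gamma> i) :]"
    for i k
    unfolding point_to_fract of_nat_to_fract[of k, where 'a = "rat poly"] to_fract_diff[symmetric]
    by (simp add: of_nat_poly)
  then show ?thesis
    by (simp add: falling_def falling_value_def peval_simps to_fract_prod)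
qed

lemma falling_value_at_0:
  "poly (falling_value n \<gamma> \<mu>) 0 = (\<Prod>i\<in>{1..n}. \<Prod>k<lookup \<mu> i. of_nat (lookup \<gamma> i) - of_nat k)"
  by (simp add: falling_value_def poly_prod)

lemma falling_value_diag: "poly (falling_value n \<gamma> \<gamma>) 0 \<noteq> 0"
  by (auto simp: falling_value_at_0)

text \<open>A different composition that is not heavier than \<mu> is smaller than \<mu> in some
  coordinate i, and there the factor with k = gamma_i vanishes.\<close>

lemma falling_value_off_diag:
  assumes "\<gamma> \<in> compositions n" "\<mu> \<in> compositions n" "\<gamma> \<noteq> \<mu>" "weight \<gamma> \<le> weight \<mu>"
  shows "poly (falling_value n \<gamma> \<mu>) 0 = 0"
proof -
  have "\<exists>i\<in>{1..n}. lookup \<gamma> i < lookup \<mu> i"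
  proof (rule ccontr)
    assume "\<not> ?thesis"
    then have le: "\<And>i. i \<in> {1..n} \<Longrightarrow> lookup \<mu> i \<le> lookup \<gamma> i"
      by (meson not_le)
    moreover have "(\<Sum>i\<in>{1..n}. lookup \<gamma> i) \<le> (\<Sum>i\<in>{1..n}. lookup \<mu> i)"
      using assms by (simp add: weight_comp)
    ultimately have "(\<Sum>i\<in>{1..n}. lookup \<mu> i) = (\<Sum>i\<in>{1..n}. lookup \<gamma> i)"
      by (meson antisym sum_mono)
    then have "lookup \<gamma> i = lookup \<mu> i" if "i \<in> {1..n}" for i
      using sum_mono_inv[of "lookup \<mu>" "{1..n}" "lookup \<gamma>" i] le that by auto
    then show False
      using assms comp_eqI by blast
  qed
  then obtain i where i: "i \<in> {1..n}" "lookup \<gamma> i < lookup \<mu> i" by blast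
  then have "(\<Prod>k<lookup \<mu> i. of_nat (lookup \<gamma> i) - of_nat k :: rat) = 0"
    by (intro prod_zero) auto
  then show ?thesis
    unfolding falling_value_at_0 using i(1) by (intro prod_zero) auto
qed

section \<open>Unisolvence\<close>

text \<open>The alternative in \<open>van\<close> admits a vanishing top-degree coefficient in place
  of a vanishing value; the normalisation of \<open>E_interp\<close> is a condition of this
  kind.\<close>

theorem unisolvent:
  assumes p: "p \<in> deg_lt n d"
    and van: "\<And>\<gamma>. \<gamma> \<in> comps_lt n d \<Longrightarrow>
      peval (point n \<gamma>) p = 0 \<or> (Suc (weight \<gamma>) = d \<and> lookup p \<gamma> = 0)"
  shows "p = 0"
proof -
  obtain c where c: "p = (\<Sum>\<mu>\<in>comps_lt n d. Const (c \<mu>) * falling n \<mu>)"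
    "\<And>\<mu>. Suc (weight \<mu>) = d \<Longrightarrow> c \<mu> = lookup p \<mu>"
    using falling_basis[OF p] by blast
  \<comment> \<open>Each row records the condition that holds at \<gamma>: the values of the falling
    factorials if \<open>p\<close> vanishes there, otherwise a row of the identity matrix, since the
    top coefficients in the falling basis are those of \<open>p\<close>.\<close>
  define A where "A \<gamma> \<mu> = (if peval (point n \<gamma>) p = 0 then falling_value n \<gamma> \<mu>
    else if \<gamma> = \<mu> then 1 else 0)" for \<gamma> \<mu>
  have "c \<mu> = 0" if "\<mu> \<in> comps_lt n d" for \<mu>
  proof (rule specialised_system_injective[of "comps_lt n d" A weight c])
    fix \<gamma> assume \<gamma>: "\<gamma> \<in> comps_lt n d"
    show "(\<Sum>\<mu>\<in>comps_lt n d. to_fract (A \<gamma> \<mu>) * c \<mu>) = 0"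
    proof (cases "peval (point n \<gamma>) p = 0")
      case True
      have "peval (point n \<gamma>) p = (\<Sum>\<mu>\<in>comps_lt n d. to_fract (A \<gamma> \<mu>) * c \<mu>)"
        using True by (subst c(1)) (simp add: peval_simps peval_falling A_def mult.commute)
      with True show ?thesis by simp
    next
      case False
      then have "c \<gamma> = 0"
        using van[OF \<gamma>] c(2) by auto
      moreover have "to_fract (A \<gamma> \<mu>) * c \<mu> = (if \<mu> = \<gamma> then c \<gamma> else 0)" for \<mu>
        using False by (simp add: A_def)
      ultimately show ?thesis by simp
    qed
  qed (use that in \<open>auto simp: A_def falling_value_diag intro!: falling_value_off_diag,
      auto simp: comps_lt_def\<close>)
  then show ?thesis
    by (subst c(1)) simp
qed

text \<open>There are as many conditions as monomials, so \<open>unisolvent\<close> gives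
  solvability as well. \<open>S\<close> collects the compositions where a coefficient is prescribed:
  one for \<open>E_interp\<close>, none for \<open>lead_vanishing_exists\<close>.\<close>

lemma interpolation_exists:
  assumes S: "\<And>\<gamma>. \<gamma> \<in> S \<Longrightarrow> Suc (weight \<gamma>) = d"
  shows "\<exists>p\<in>deg_lt n d. \<forall>\<gamma>\<in>comps_lt n d.
    (if \<gamma> \<in> S then lookup p \<gamma> else peval (point n \<gamma>) p) = b \<gamma>"
proof -
  define P where "P c = (\<Sum>\<mu>\<in>comps_lt n d. Const (c \<mu>) * monom_of \<mu>)" for c
  define A where "A \<gamma> \<mu> = (if \<gamma> \<in> S then if \<gamma> = \<mu> then 1 else 0
    else peval (point n \<gamma>) (monom_of \<mu>))" for \<gamma> \<mu>
  have P: "P c \<in> deg_lt n d" for c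
    unfolding P_def by (intro deg_lt_sum deg_lt_Const_mult deg_lt_monom) (auto simp: comps_lt_def)
  have lookup_P: "lookup (P c) \<gamma> = c \<gamma>" if "\<gamma> \<in> comps_lt n d" for c \<gamma>
  proof -
    have "lookup (P c) \<gamma> = (\<Sum>\<mu>\<in>comps_lt n d. if \<mu> = \<gamma> then c \<gamma> else 0)"
      unfolding P_def lookup_sum lookup_Const_mult
      by (rule sum.cong) (auto simp: monom_of_def lookup_single)
    with that show ?thesis by simp
  qed
  have A: "(\<Sum>\<mu>\<in>comps_lt n d. A \<gamma> \<mu> * c \<mu>)
    = (if \<gamma> \<in> S then lookup (P c) \<gamma> else peval (point n \<gamma>) (P c))"
    if "\<gamma> \<in> comps_lt n d" for c \<gamma>
  proof (cases "\<gamma> \<in> S")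
    case True
    have "A \<gamma> \<mu> * c \<mu> = (if \<mu> = \<gamma> then c \<gamma> else 0)" for \<mu>
      using True by (simp add: A_def)
    then show ?thesis
      using True that by (simp add: lookup_P)
  next
    case False
    then show ?thesis
      by (simp add: A_def P_def peval_simps mult.commute)
  qed
  have "\<exists>c. \<forall>\<gamma>\<in>comps_lt n d. (\<Sum>\<mu>\<in>comps_lt n d. A \<gamma> \<mu> * c \<mu>) = b \<gamma>"
  proof (rule square_system_solvable)
    fix c assume *: "\<And>\<gamma>. \<gamma> \<in> comps_lt n d \<Longrightarrow> (\<Sum>\<mu>\<in>comps_lt n d. A \<gamma> \<mu> * c \<mu>) = 0"
    have "P c = 0"
    proof (rule unisolvent[OF P])
      fix \<gamma> assume "\<gamma> \<in> comps_lt n d"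
      then show "peval (point n \<gamma>) (P c) = 0 \<or> Suc (weight \<gamma>) = d \<and> lookup (P c) \<gamma> = 0"
        using *[of \<gamma>] A[of \<gamma> c] S[of \<gamma>] by (auto split: if_splits)
    qed
    then show "\<forall>\<mu>\<in>comps_lt n d. c \<mu> = 0"
      using lookup_P[of _ c] by simp
  qed simp
  then show ?thesis
    using A P by metis
qed

lemma unisolvent_neg:
  assumes "p \<in> deg_lt n d" "\<And>\<gamma>. \<gamma> \<in> comps_lt n d \<Longrightarrow> peval (\<lambda>i. - point n \<gamma> i) p = 0"
  shows "p = 0"
proof -
  have "neg p = 0"
    using assms by (intro unisolvent[of "neg p" n d]) (auto simp: neg_deg_lt peval_neg)
  then have "neg (neg p) = 0"
    by (simp add: neg_def psubst_simps)
  then show ?thesis by simp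
qed


section \<open>Interpolation polynomials and the identification of \<open>Xi\<close>\<close>

section \<open>Interpolation polynomials\<close>

lemma E_interp_unique:
  assumes "\<eta> \<in> compositions n"
  shows "\<exists>!p. p \<in> polys n \<and> total_degree p = weight \<eta> \<and>
     (\<forall>\<gamma>\<in>compositions n. \<gamma> \<noteq> \<eta> \<and> weight \<gamma> \<le> weight \<eta> \<longrightarrow> peval (point n \<gamma>) p = 0) \<and>
     lookup p \<eta> = 1"
proof (rule ex_ex1I)
  obtain p where p: "p \<in> deg_lt n (Suc (weight \<eta>))"
    "\<And>\<gamma>. \<gamma> \<in> comps_lt n (Suc (weight \<eta>)) \<Longrightarrow>
      (if \<gamma> \<in> {\<eta>} then lookup p \<gamma> else peval (point n \<gamma>) p) = (if \<gamma> = \<eta> then 1 else 0)"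
    using interpolation_exists[of "{\<eta>}" "Suc (weight \<eta>)" n "\<lambda>\<gamma>. if \<gamma> = \<eta> then 1 else 0"] by auto
  have lead: "lookup p \<eta> = 1"
    using p(2)[of \<eta>] assms by (simp add: comps_lt_def)
  moreover have "peval (point n \<gamma>) p = 0"
    if "\<gamma> \<in> compositions n" "\<gamma> \<noteq> \<eta>" "weight \<gamma> \<le> weight \<eta>" for \<gamma>
    using p(2)[of \<gamma>] that by (simp add: comps_lt_def)
  ultimately show "\<exists>p. p \<in> polys n \<and> total_degree p = weight \<eta> \<and>
     (\<forall>\<gamma>\<in>compositions n. \<gamma> \<noteq> \<eta> \<and> weight \<gamma> \<le> weight \<eta> \<longrightarrow> peval (point n \<gamma>) p = 0) \<and>
     lookup p \<eta> = 1"
    using deg_lt_polys[OF p(1)] total_degree_eqI[OF p(1), of \<eta>] by auto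
next
  fix p q
  assume p: "p \<in> polys n \<and> total_degree p = weight \<eta> \<and>
     (\<forall>\<gamma>\<in>compositions n. \<gamma> \<noteq> \<eta> \<and> weight \<gamma> \<le> weight \<eta> \<longrightarrow> peval (point n \<gamma>) p = 0) \<and>
     lookup p \<eta> = 1"
    and q: "q \<in> polys n \<and> total_degree q = weight \<eta> \<and>
     (\<forall>\<gamma>\<in>compositions n. \<gamma> \<noteq> \<eta> \<and> weight \<gamma> \<le> weight \<eta> \<longrightarrow> peval (point n \<gamma>) q = 0) \<and>
     lookup q \<eta> = 1"
  have "p - q = 0"
  proof (rule unisolvent)
    show "p - q \<in> deg_lt n (Suc (weight \<eta>))"
      using p q by (intro deg_lt_diff deg_lt_total_degree) auto
    fix \<gamma> assume "\<gamma> \<in> comps_lt n (Suc (weight \<eta>))"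
    then show "peval (point n \<gamma>) (p - q) = 0 \<or> Suc (weight \<gamma>) = Suc (weight \<eta>) \<and> lookup (p - q) \<gamma> = 0"
      using p q by (cases "\<gamma> = \<eta>") (simp_all add: peval_simps lookup_minus comps_lt_def)
  qed
  then show "p = q" by simp
qed

lemma E_interp:
  assumes "\<eta> \<in> compositions n"
  shows E_interp_total_degree: "total_degree (E_interp n \<eta>) = weight \<eta>"
    and E_interp_deg_lt: "E_interp n \<eta> \<in> deg_lt n (Suc (weight \<eta>))"
    and E_interp_vanish: "\<And>\<gamma>. \<gamma> \<in> compositions n \<Longrightarrow> \<gamma> \<noteq> \<eta> \<Longrightarrow> weight \<gamma> \<le> weight \<eta> \<Longrightarrow>
      peval (point n \<gamma>) (E_interp n \<eta>) = 0"
    and E_interp_lead: "lookup (E_interp n \<eta>) \<eta> = 1"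
  using theI'[OF E_interp_unique[OF assms], folded E_interp_def] deg_lt_total_degree by auto

text \<open>Otherwise the polynomial would vanish at every point of weight at most |eta| and be zero
  by unisolvence. The value serves as the denominator when expanding in the
  \<open>E_interp\<close>.\<close>

lemma E_interp_self:
  assumes "\<eta> \<in> compositions n"
  shows "peval (point n \<eta>) (E_interp n \<eta>) \<noteq> 0"
proof
  assume *: "peval (point n \<eta>) (E_interp n \<eta>) = 0"
  have "peval (point n \<gamma>) (E_interp n \<eta>) = 0" if "\<gamma> \<in> comps_lt n (Suc (weight \<eta>))" for \<gamma>
    using that * E_interp_vanish[OF assms, of \<gamma>] by (cases "\<gamma> = \<eta>") (auto simp: comps_lt_def)
  then have "E_interp n \<eta> = 0"
    using unisolvent[OF E_interp_deg_lt[OF assms]] by blast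
  then show False
    using E_interp_lead[OF assms] by simp
qed

lemma lookup_top_component:
  "lookup (top_component p) m = (if weight m = total_degree p then lookup p m else 0)"
proof -
  have "lookup (top_component p) m
    = (\<Sum>k\<in>{k \<in> keys p. weight k = total_degree p}. if k = m then lookup p m else 0)"
    unfolding top_component_def lookup_sum by (rule sum.cong) (auto simp: lookup_single)
  then show ?thesis
    by (auto simp: in_keys_iff)
qed

lemma lookup_E_jack:
  "\<eta> \<in> compositions n \<Longrightarrow>
    lookup (E_jack n \<eta>) m = (if weight m = weight \<eta> then lookup (E_interp n \<eta>) m else 0)"
  by (simp add: E_jack_def lookup_top_component E_interp_total_degree)

text \<open>In the ordering of Q(r) in which r is positive and infinitely large, every factor is
  positive.\<close>

lemma d_const_nonzero: "d_const n \<eta> \<noteq> 0"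
proof -
  have "r > 0"
    by (simp add: r_def zero_less_Fract_iff less_poly_def pos_poly_def)
  then have "alpha > 0"
    by (simp add: alpha_def)
  then have "alpha * of_nat (a + 1) + of_nat b + 1 > 0" for a b
    by (intro add_nonneg_pos add_nonneg_nonneg) auto
  then have "d_const n \<eta> > 0"
    unfolding d_const_def by (intro prod_pos) auto
  then show ?thesis by simp
qed

section \<open>Characterisation of the factorial monomials\<close>

text \<open>One vanishing condition for each possible lower-order monomial; nothing is imposed at
  points of weight |mu|, the top component being prescribed instead.\<close>

definition is_factorial :: "nat \<Rightarrow> expo \<Rightarrow> mpoly \<Rightarrow> bool" where
  "is_factorial n \<mu> p \<longleftrightarrow> has_lead n \<mu> p \<and>
    (\<forall>\<gamma>\<in>comps_lt n (weight \<mu>). peval (\<lambda>i. - point n \<gamma> i) p = 0)"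

lemma is_factorial_unique: "is_factorial n \<mu> p \<Longrightarrow> is_factorial n \<mu> q \<Longrightarrow> p = q"
  using unisolvent_neg[of "p - q" n "weight \<mu>"]
    deg_lt_diff[of "p - monom_of \<mu>" n "weight \<mu>" "q - monom_of \<mu>"]
  by (simp add: is_factorial_def has_lead_def peval_simps)

text \<open>The lower-order part interpolates -x^mu at the points of smaller weight. Reflection
  turns the result into a factorial monomial; unreflected, it yields the expansion of x^mu in the
  \<open>F_jack\<close>.\<close>

lemma lead_vanishing_exists:
  assumes "\<mu> \<in> compositions n"
  shows "\<exists>p. has_lead n \<mu> p \<and> (\<forall>\<gamma>\<in>comps_lt n (weight \<mu>). peval (point n \<gamma>) p = 0)"
proof -
  obtain q where q: "q \<in> deg_lt n (weight \<mu>)"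
    "\<forall>\<gamma>\<in>comps_lt n (weight \<mu>). peval (point n \<gamma>) q = - peval (point n \<gamma>) (monom_of \<mu>)"
    using interpolation_exists[of "{}" "weight \<mu>" n "\<lambda>\<gamma>. - peval (point n \<gamma>) (monom_of \<mu>)"] by auto
  then show ?thesis
    using has_lead_add[OF has_lead_monom[OF assms] q(1)]
    by (intro exI[of _ "monom_of \<mu> + q"]) (simp add: peval_simps)
qed

lemma is_factorial_exists:
  assumes "\<mu> \<in> compositions n"
  shows "\<exists>p. is_factorial n \<mu> p"
proof -
  obtain p where p: "has_lead n \<mu> p" "\<And>\<gamma>. \<gamma> \<in> comps_lt n (weight \<mu>) \<Longrightarrow> peval (point n \<gamma>) p = 0"
    using lead_vanishing_exists[OF assms] by blast
  \<comment> \<open>Reflection moves the zeros to the negated points and multiplies the leading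
    coefficient by the sign, which is cancelled here.\<close>
  let ?q = "Const ((- 1) ^ weight \<mu>) * neg p"
  have "?q - monom_of \<mu> = Const ((- 1) ^ weight \<mu>) * neg (p - monom_of \<mu>)"
    by (rule poly_mapping_eqI)
      (auto simp: lookup_minus lookup_Const_mult lookup_neg monom_of_def lookup_single when_def
        right_diff_distrib simp flip: power_add mult.assoc)
  then have "is_factorial n \<mu> ?q"
    using p unfolding is_factorial_def has_lead_def
    by (auto simp: peval_simps peval_neg intro: deg_lt_Const_mult neg_deg_lt)
  then show ?thesis ..
qed

definition factorial :: "nat \<Rightarrow> expo \<Rightarrow> mpoly" where
  "factorial n \<mu> = (SOME p. is_factorial n \<mu> p)"

lemma is_factorial_factorial: "\<mu> \<in> compositions n \<Longrightarrow> is_factorial n \<mu> (factorial n \<mu>)"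
  unfolding factorial_def by (rule someI_ex) (rule is_factorial_exists)

lemma factorial_polys: "\<mu> \<in> compositions n \<Longrightarrow> factorial n \<mu> \<in> polys n"
  using is_factorial_factorial unfolding is_factorial_def by (meson has_lead_deg_lt deg_lt_polys)

definition factorial_map :: "nat \<Rightarrow> mpoly \<Rightarrow> mpoly" where
  "factorial_map n p = (\<Sum>m\<in>keys p. Const (lookup p m) * factorial n m)"

lemma factorial_map_add: "factorial_map n (p + q) = factorial_map n p + factorial_map n q"
  unfolding factorial_map_def
  by (rule setsum_keys_plus_distrib) (simp_all add: Const_add distrib_right)

lemma factorial_map_scale: "factorial_map n (Const c * p) = Const c * factorial_map n p"
proof -
  have "factorial_map n (Const c * p) = (\<Sum>m\<in>keys p. Const (lookup (Const c * p) m) * factorial n m)"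
    unfolding factorial_map_def
    by (rule sum.mono_neutral_left) (auto simp: keys_Const_mult in_keys_iff lookup_Const_mult)
  then show ?thesis
    by (simp add: factorial_map_def lookup_Const_mult Const_mult sum_distrib_left mult.assoc)
qed

lemma factorial_map_monom: "factorial_map n (monom_of \<mu>) = factorial n \<mu>"
  by (simp add: factorial_map_def monom_of_def)

lemma factorial_map_polys: "p \<in> polys n \<Longrightarrow> factorial_map n p \<in> polys n"
  unfolding factorial_map_def
  by (intro polys_sum polys_Const_mult factorial_polys) (auto simp: polys_def)

text \<open>Both sides agree in degree \<open>|\<eta>|\<close> and vanish at all points \<open>- point n \<gamma>\<close> with
  \<open>|\<gamma>| < |\<eta>|\<close>; the factor \<open>d_const\<close> cancels.\<close>

lemma factorial_map_F_jack:
  assumes \<eta>: "\<eta> \<in> compositions n"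
  shows "factorial_map n (F_jack n \<eta>) = F_interp n \<eta>"
proof -
  let ?G = "Const ((- 1) ^ weight \<eta>) * neg (E_interp n \<eta>)"
  have keys: "m \<in> compositions n" "weight m = weight \<eta>" if "m \<in> keys (E_jack n \<eta>)" for m
    using that \<eta> E_interp_deg_lt[OF \<eta>] by (auto simp: in_keys_iff lookup_E_jack deg_lt_iff split: if_splits)
  have fac: "is_factorial n m (factorial n m)" if "m \<in> keys (E_jack n \<eta>)" for m
    using keys[OF that] by (rule_tac is_factorial_factorial)
  have "factorial_map n (E_jack n \<eta>) - ?G = 0"
  proof (rule unisolvent_neg[of _ n "weight \<eta>"])
    have "factorial_map n (E_jack n \<eta>) - E_jack n \<eta>
      = (\<Sum>m\<in>keys (E_jack n \<eta>). Const (lookup (E_jack n \<eta>) m) * (factorial n m - monom_of m))"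
      by (subst (3) monom_sum) (simp add: factorial_map_def right_diff_distrib sum_subtractf)
    also have "\<dots> \<in> deg_lt n (weight \<eta>)"
      using fac keys by (intro deg_lt_sum deg_lt_Const_mult) (metis has_lead_def is_factorial_def)
    finally have "factorial_map n (E_jack n \<eta>) - E_jack n \<eta> \<in> deg_lt n (weight \<eta>)" .
    moreover have "E_jack n \<eta> - ?G \<in> deg_lt n (weight \<eta>)"
    proof (rule deg_lt_dest)
      have "E_jack n \<eta> \<in> deg_lt n (Suc (weight \<eta>))"
        using keys by (auto simp: deg_lt_def polys_def)
      then show "E_jack n \<eta> - ?G \<in> deg_lt n (Suc (weight \<eta>))"
        using E_interp_deg_lt[OF \<eta>] by (intro deg_lt_diff deg_lt_Const_mult neg_deg_lt)
      show "lookup (E_jack n \<eta> - ?G) m = 0" if "weight m = weight \<eta>" for m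
        using that \<eta> by (simp add: lookup_minus lookup_E_jack lookup_Const_mult lookup_neg
          flip: mult.assoc power_add)
    qed
    ultimately show "factorial_map n (E_jack n \<eta>) - ?G \<in> deg_lt n (weight \<eta>)"
      using deg_lt_add by fastforce
  next
    fix \<gamma> assume \<gamma>: "\<gamma> \<in> comps_lt n (weight \<eta>)"
    have "peval (\<lambda>i. - point n \<gamma> i) (factorial n m) = 0" if "m \<in> keys (E_jack n \<eta>)" for m
      using fac[OF that] keys[OF that] \<gamma> by (simp add: is_factorial_def)
    moreover have "peval (point n \<gamma>) (E_interp n \<eta>) = 0"
      using \<gamma> by (intro E_interp_vanish[OF \<eta>]) (auto simp: comps_lt_def)
    ultimately show "peval (\<lambda>i. - point n \<gamma> i) (factorial_map n (E_jack n \<eta>) - ?G) = 0"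
      by (simp add: peval_simps factorial_map_def peval_neg)
  qed
  then show ?thesis
    unfolding F_jack_def F_interp_def factorial_map_scale by (simp add: Const_mult neg_def mult_ac)
qed

text \<open>A polynomial x^mu + (lower degree) vanishing at all points of smaller weight is
  determined by its values at weight |mu|, hence is a combination of the \<open>E_interp\<close> of
  that weight. Its top component gives the expansion of x^mu.\<close>

lemma monom_F_jack_expansion:
  assumes \<mu>: "\<mu> \<in> compositions n"
  shows "\<exists>e S. finite S \<and> S \<subseteq> compositions n \<and> monom_of \<mu> = (\<Sum>\<eta>\<in>S. Const (e \<eta>) * F_jack n \<eta>)"
proof -
  define S where "S = {\<eta> \<in> comps_lt n (Suc (weight \<mu>)). weight \<eta> = weight \<mu>}"
  have S: "finite S" "S \<subseteq> compositions n" "\<And>\<eta>. \<eta> \<in> S \<Longrightarrow> weight \<eta> = weight \<mu>"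
    using finite_subset[OF _ finite_comps_lt, of S n "Suc (weight \<mu>)"]
    by (auto simp: S_def) (auto simp: comps_lt_def)
  obtain p where p: "has_lead n \<mu> p" "\<And>\<gamma>. \<gamma> \<in> comps_lt n (weight \<mu>) \<Longrightarrow> peval (point n \<gamma>) p = 0"
    using lead_vanishing_exists[OF \<mu>] by blast
  \<comment> \<open>Evaluation at \<open>point n \<eta>\<close> annihilates every other
    \<open>E_interp\<close> of the same weight, which forces this ratio.\<close>
  define e where "e \<eta> = peval (point n \<eta>) p / peval (point n \<eta>) (E_interp n \<eta>)" for \<eta>
  have "p - (\<Sum>\<eta>\<in>S. Const (e \<eta>) * E_interp n \<eta>) = 0"
  proof (rule unisolvent)
    show "p - (\<Sum>\<eta>\<in>S. Const (e \<eta>) * E_interp n \<eta>) \<in> deg_lt n (Suc (weight \<mu>))"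
      using E_interp_deg_lt S by (intro deg_lt_diff has_lead_deg_lt[OF p(1)] deg_lt_sum deg_lt_Const_mult) fastforce
    fix \<gamma> assume \<gamma>: "\<gamma> \<in> comps_lt n (Suc (weight \<mu>))"
    then have \<gamma>c: "\<gamma> \<in> compositions n" "weight \<gamma> \<le> weight \<mu>"
      by (auto simp: comps_lt_def)
    have "e \<eta> * peval (point n \<gamma>) (E_interp n \<eta>) = (if \<eta> = \<gamma> then peval (point n \<gamma>) p else 0)"
      if "\<eta> \<in> S" for \<eta>
      using that S \<gamma>c E_interp_vanish[of \<eta> n \<gamma>] E_interp_self[of \<eta> n]
      by (auto simp: e_def)
    then have "peval (point n \<gamma>) (\<Sum>\<eta>\<in>S. Const (e \<eta>) * E_interp n \<eta>)
      = (\<Sum>\<eta>\<in>S. if \<eta> = \<gamma> then peval (point n \<gamma>) p else 0)"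
      by (simp add: peval_simps)
    also have "\<dots> = peval (point n \<gamma>) p"
      using S(1) \<gamma> p(2)[of \<gamma>] by (auto simp: S_def comps_lt_def less_Suc_eq)
    finally show "peval (point n \<gamma>) (p - (\<Sum>\<eta>\<in>S. Const (e \<eta>) * E_interp n \<eta>)) = 0 \<or>
      Suc (weight \<gamma>) = Suc (weight \<mu>) \<and> lookup (p - (\<Sum>\<eta>\<in>S. Const (e \<eta>) * E_interp n \<eta>)) \<gamma> = 0"
      by (simp add: peval_simps)
  qed
  then have p_eq: "p = (\<Sum>\<eta>\<in>S. Const (e \<eta>) * E_interp n \<eta>)" by simp
  have "monom_of \<mu> = (\<Sum>\<eta>\<in>S. Const (e \<eta>) * E_jack n \<eta>)"
  proof (rule poly_mapping_eqI)
    fix m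
    have "lookup (\<Sum>\<eta>\<in>S. Const (e \<eta>) * E_jack n \<eta>) m
      = (if weight m = weight \<mu> then lookup p m else 0)"
      using S by (subst p_eq) (auto simp: lookup_sum lookup_Const_mult lookup_E_jack subset_iff)
    also have "\<dots> = lookup (monom_of \<mu>) m"
      using has_lead_cases[OF p(1), of m] by (auto simp: monom_of_def lookup_single)
    finally show "lookup (monom_of \<mu>) m = lookup (\<Sum>\<eta>\<in>S. Const (e \<eta>) * E_jack n \<eta>) m" ..
  qed
  also have "\<dots> = (\<Sum>\<eta>\<in>S. Const (e \<eta> / d_const n \<eta>) * F_jack n \<eta>)"
  proof (rule sum.cong)
    fix \<eta>
    have "Const (e \<eta>) = Const (e \<eta> / d_const n \<eta>) * Const (d_const n \<eta>)"
      by (simp only: Const_mult[symmetric]) (simp add: d_const_nonzero)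
    then show "Const (e \<eta>) * E_jack n \<eta> = Const (e \<eta> / d_const n \<eta>) * F_jack n \<eta>"
      by (simp only: F_jack_def mult.assoc)
  qed simp
  finally show ?thesis
    using S(1,2) by (intro exI[of _ "\<lambda>\<eta>. e \<eta> / d_const n \<eta>"] exI[of _ S]) simp
qed

definition is_Xi :: "nat \<Rightarrow> (mpoly \<Rightarrow> mpoly) \<Rightarrow> bool" where
  "is_Xi n X \<longleftrightarrow> X \<in> polys n \<rightarrow>\<^sub>E polys n \<and>
     (\<forall>p\<in>polys n. \<forall>q\<in>polys n. X (p + q) = X p + X q) \<and>
     (\<forall>c. \<forall>p\<in>polys n. X (Const c * p) = Const c * X p) \<and>
     (\<forall>\<eta>\<in>compositions n. X (F_jack n \<eta>) = F_interp n \<eta>)"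

lemma is_Xi_sum:
  assumes "is_Xi n X" "finite A" "\<And>a. a \<in> A \<Longrightarrow> f a \<in> polys n"
  shows "X (\<Sum>a\<in>A. Const (c a) * f a) = (\<Sum>a\<in>A. Const (c a) * X (f a))"
  using assms(2,3)
proof (induction A rule: finite_induct)
  case empty
  have "X (Const 0 * 0) = Const 0 * X 0"
    using assms(1) polys_zero unfolding is_Xi_def by blast
  then show ?case by simp
next
  case (insert a A)
  then have "Const (c a) * f a \<in> polys n" "(\<Sum>a\<in>A. Const (c a) * f a) \<in> polys n"
    by (auto intro: polys_Const_mult polys_sum)
  then show ?case
    using insert assms(1) by (simp add: is_Xi_def)
qed

lemma F_jack_polys: "\<eta> \<in> compositions n \<Longrightarrow> F_jack n \<eta> \<in> polys n"
  using E_interp_deg_lt[of \<eta> n]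
  by (auto simp: polys_iff F_jack_def lookup_Const_mult lookup_E_jack deg_lt_iff split: if_splits)

text \<open>Existence is \<open>factorial_map_F_jack\<close>. For uniqueness, the values on the
  \<open>F_jack\<close> determine those on monomials by \<open>monom_F_jack_expansion\<close>, and
  linearity does the rest.\<close>

lemma Xi_eq: "Xi n = restrict (factorial_map n) (polys n)"
  unfolding Xi_def is_Xi_def[symmetric]
proof (rule the_equality)
  show Y: "is_Xi n (restrict (factorial_map n) (polys n))"
    unfolding is_Xi_def
    by (auto simp: factorial_map_polys factorial_map_add factorial_map_scale polys_add polys_Const_mult
      factorial_map_F_jack F_jack_polys)
  fix X assume X: "is_Xi n X"
  have F: "X (F_jack n \<eta>) = restrict (factorial_map n) (polys n) (F_jack n \<eta>)" if "\<eta> \<in> compositions n" for \<eta>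
    using X Y that by (simp add: is_Xi_def)
  have m: "X (monom_of \<mu>) = restrict (factorial_map n) (polys n) (monom_of \<mu>)" if \<mu>: "\<mu> \<in> compositions n" for \<mu>
  proof -
    obtain e S where S: "finite S" "S \<subseteq> compositions n"
      and eq: "monom_of \<mu> = (\<Sum>\<eta>\<in>S. Const (e \<eta>) * F_jack n \<eta>)"
      using monom_F_jack_expansion[OF \<mu>] by blast
    have pol: "F_jack n \<eta> \<in> polys n" if "\<eta> \<in> S" for \<eta>
      using S(2) that by (auto intro: F_jack_polys)
    have "X (monom_of \<mu>) = (\<Sum>\<eta>\<in>S. Const (e \<eta>) * X (F_jack n \<eta>))"
      unfolding eq by (rule is_Xi_sum[OF X S(1) pol])
    also have "\<dots> = (\<Sum>\<eta>\<in>S. Const (e \<eta>) * restrict (factorial_map n) (polys n) (F_jack n \<eta>))"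
      using S(2) F by (intro sum.cong) (auto simp del: restrict_apply)
    also have "\<dots> = restrict (factorial_map n) (polys n) (monom_of \<mu>)"
      unfolding eq by (rule is_Xi_sum[OF Y S(1) pol, symmetric])
    finally show ?thesis .
  qed
  show "X = restrict (factorial_map n) (polys n)"
  proof
    fix p
    show "X p = restrict (factorial_map n) (polys n) p"
    proof (cases "p \<in> polys n")
      case True
      then have pol: "monom_of \<mu> \<in> polys n" and \<mu>c: "\<mu> \<in> compositions n" if "\<mu> \<in> keys p" for \<mu>
        using that by (auto simp: polys_def monom_of_def)
      let ?q = "\<Sum>\<mu>\<in>keys p. Const (lookup p \<mu>) * monom_of \<mu>"
      have "X ?q = (\<Sum>\<mu>\<in>keys p. Const (lookup p \<mu>) * X (monom_of \<mu>))"
        by (rule is_Xi_sum[OF X _ pol]) simp_all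
      also have "\<dots> = (\<Sum>\<mu>\<in>keys p. Const (lookup p \<mu>) * restrict (factorial_map n) (polys n) (monom_of \<mu>))"
        using m[OF \<mu>c] by (intro sum.cong) (auto simp del: restrict_apply)
      also have "\<dots> = restrict (factorial_map n) (polys n) ?q"
        by (rule is_Xi_sum[OF Y _ pol, symmetric]) simp_all
      finally show ?thesis
        by (simp only: monom_sum[symmetric])
    next
      case False
      \<comment> \<open>Outside \<open>polys n\<close> both maps take the value
        \<open>undefined\<close>.\<close>
      then show ?thesis
        using X PiE_arb[of X "polys n" "\<lambda>_. polys n" p] by (simp add: is_Xi_def)
    qed
  qed
qed

lemma fact_monom_eq:
  assumes "\<mu> \<in> compositions n"
  shows "fact_monom n \<mu> = factorial n \<mu>"
proof -
  have "monom_of \<mu> \<in> polys n"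
    using assms by (simp add: polys_def monom_of_def)
  then show ?thesis
    by (simp add: fact_monom_def Xi_eq factorial_map_monom)
qed

section \<open>Divided differences and compatibility with the generators\<close>

section \<open>Divided differences\<close>

text \<open>The bounds on \<open>f\<close> and on its swap are carried along because the quotient
  for a product involves a factor and a swapped factor.\<close>

definition has_divdiff :: "nat \<Rightarrow> nat \<Rightarrow> nat \<Rightarrow> mpoly \<Rightarrow> bool" where
  "has_divdiff n i d f \<longleftrightarrow> f \<in> deg_lt n (Suc d) \<and> swap_poly i f \<in> deg_lt n (Suc d) \<and>
    (\<exists>g\<in>deg_lt n d. (Var i - Var (Suc i)) * g = swap_poly i f - f)"

text \<open>The twisted Leibniz rule: s(fg) - fg = (sf - f) sg + (sg - g) f.\<close>

lemma has_divdiff_mult: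
  assumes "has_divdiff n i a f" "has_divdiff n i b g"
  shows "has_divdiff n i (a + b) (f * g)"
proof -
  obtain f' g' where f': "f' \<in> deg_lt n a" "(Var i - Var (Suc i)) * f' = swap_poly i f - f"
    and g': "g' \<in> deg_lt n b" "(Var i - Var (Suc i)) * g' = swap_poly i g - g"
    using assms unfolding has_divdiff_def by blast
  have sw: "swap_poly i (f * g) = swap_poly i f * swap_poly i g"
    by (simp add: swap_poly_def psubst_simps)
  have "(Var i - Var (Suc i)) * (f' * swap_poly i g + g' * f)
    = ((Var i - Var (Suc i)) * f') * swap_poly i g + ((Var i - Var (Suc i)) * g') * f"
    by (simp add: algebra_simps)
  also have "\<dots> = swap_poly i (f * g) - f * g"
    unfolding f' g' sw by (simp add: algebra_simps)
  finally have "(Var i - Var (Suc i)) * (f' * swap_poly i g + g' * f) = swap_poly i (f * g) - f * g" .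
  moreover have "f' * swap_poly i g + g' * f \<in> deg_lt n (a + b)"
    using deg_lt_mult[of f' n a "swap_poly i g" b] deg_lt_mult[of g' n b f a] f' g' assms
    by (intro deg_lt_add) (auto simp: has_divdiff_def add.commute)
  moreover have "f * g \<in> deg_lt n (Suc (a + b))" "swap_poly i (f * g) \<in> deg_lt n (Suc (a + b))"
    using deg_lt_mult[of f n "Suc a" g b] deg_lt_mult[of "swap_poly i f" n "Suc a" "swap_poly i g" b] assms
    by (auto simp: has_divdiff_def sw)
  ultimately show ?thesis
    unfolding has_divdiff_def by blast
qed

lemma has_divdiff_1: "has_divdiff n i 0 1"
  using has_lead_deg_lt[OF has_lead_1, of n]
  by (auto simp: has_divdiff_def swap_poly_def psubst_simps)

lemma has_divdiff_Var:
  assumes "1 \<le> i" "i \<le> n - 1" "j \<in> {1..n}"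
  shows "has_divdiff n i 1 (Var j)"
proof -
  have sw: "swap_poly i (Var j) = Var (transpose i (Suc i) j)"
    by (simp add: swap_poly_def psubst_simps)
  have "Var k \<in> deg_lt n (Suc 1)" if "k \<in> {1..n}" for k
    using has_lead_deg_lt[OF has_lead_Var[OF that]] by simp
  moreover have "\<exists>g\<in>deg_lt n 1. (Var i - Var (Suc i)) * g = swap_poly i (Var j) - Var j"
  proof -
    define c :: ratfun where "c = (if j = i then - 1 else if j = Suc i then 1 else 0)"
    have "(Var i - Var (Suc i)) * Const c = swap_poly i (Var j) - Var j"
      by (auto simp: sw c_def transpose_def Const_uminus)
    then show ?thesis
      using Const_deg_lt by blast
  qed
  ultimately show ?thesis
    using assms by (simp add: has_divdiff_def sw transpose_range del: atLeastAtMost_iff)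
qed

lemma has_divdiff_monom:
  assumes "1 \<le> i" "i \<le> n - 1" "\<mu> \<in> compositions n"
  shows "has_divdiff n i (weight \<mu>) (monom_of \<mu>)"
proof -
  have pow: "has_divdiff n i k (Var j ^ k)" if "j \<in> {1..n}" for j k
  proof (induction k)
    case (Suc k)
    then show ?case
      using has_divdiff_mult[OF has_divdiff_Var[OF assms(1,2) that] Suc.IH] by (simp flip: Suc_eq_plus1_left)
  qed (simp add: has_divdiff_1)
  have "has_divdiff n i (\<Sum>j\<in>A. lookup \<mu> j) (\<Prod>j\<in>A. Var j ^ lookup \<mu> j)" if "A \<subseteq> {1..n}" for A
    using that
    by (induction A rule: infinite_finite_induct) (auto simp: has_divdiff_1 intro!: has_divdiff_mult pow)
  then show ?thesis
    using assms(3) by (simp add: monom_prod weight_def compositions_def)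
qed

lemma swap_poly_linear:
  "swap_poly i (f - g) = swap_poly i f - swap_poly i g"
  "swap_poly i (Const c * f) = Const c * swap_poly i f"
  "swap_poly i (sum h A) = (\<Sum>a\<in>A. swap_poly i (h a))"
  by (simp_all add: swap_poly_def psubst_simps)

lemma Var_diff_nonzero: "Var i - Var (Suc i) \<noteq> 0"
proof
  assume "Var i - Var (Suc i) = 0"
  then have "peval (\<lambda>j. if j = i then 1 else 0) (Var i - Var (Suc i)) = 0"
    by (simp add: peval_simps)
  then show False
    by (simp add: peval_simps)
qed

text \<open>Quotients exist for monomials, being products of variables, and extend linearly;
  \<open>Var_diff_nonzero\<close> makes them unique. The drop in degree makes the second summand of
  \<open>sigma_plus\<close> a lower-order correction.\<close>

lemma divdiff_properties:
  assumes i: "1 \<le> i" "i \<le> n - 1" and f: "f \<in> deg_lt n (Suc d)"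
  shows divdiff_deg_lt: "divdiff i f \<in> deg_lt n d"
    and divdiff_mult: "(Var i - Var (Suc i)) * divdiff i f = swap_poly i f - f"
proof -
  have "\<exists>g\<in>deg_lt n d. (Var i - Var (Suc i)) * g = swap_poly i (monom_of m) - monom_of m"
    if "m \<in> keys f" for m
  proof -
    have "m \<in> compositions n" "weight m \<le> d"
      using that f by (auto simp: deg_lt_def polys_def)
    then show ?thesis
      using has_divdiff_monom[OF i, of m] deg_lt_mono by (auto simp: has_divdiff_def)
  qed
  then obtain G where G: "\<And>m. m \<in> keys f \<Longrightarrow> G m \<in> deg_lt n d"
    "\<And>m. m \<in> keys f \<Longrightarrow> (Var i - Var (Suc i)) * G m = swap_poly i (monom_of m) - monom_of m"
    by metis
  define g where "g = (\<Sum>m\<in>keys f. Const (lookup f m) * G m)"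
  have g: "g \<in> deg_lt n d"
    unfolding g_def using G(1) by (intro deg_lt_sum deg_lt_Const_mult)
  have "(Var i - Var (Suc i)) * g = (\<Sum>m\<in>keys f. Const (lookup f m) * ((Var i - Var (Suc i)) * G m))"
    by (simp only: g_def sum_distrib_left mult.left_commute)
  also have "\<dots> = (\<Sum>m\<in>keys f. Const (lookup f m) * (swap_poly i (monom_of m) - monom_of m))"
    using G(2) by (intro sum.cong) auto
  also have "\<dots> = swap_poly i (\<Sum>m\<in>keys f. Const (lookup f m) * monom_of m)
    - (\<Sum>m\<in>keys f. Const (lookup f m) * monom_of m)"
    by (simp add: swap_poly_linear right_diff_distrib sum_subtractf)
  finally have eq: "(Var i - Var (Suc i)) * g = swap_poly i f - f"
    by (simp only: monom_sum[symmetric])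
  then have "divdiff i f = g"
    unfolding divdiff_def using Var_diff_nonzero[of i]
    by (intro the_equality) (auto simp flip: eq)
  with g eq show "divdiff i f \<in> deg_lt n d" "(Var i - Var (Suc i)) * divdiff i f = swap_poly i f - f"
    by simp_all
qed

section \<open>The generators preserve the characterisation\<close>

text \<open>The swap alone moves the leading monomial correctly and keeps the zeros at points with
  unequal neighbouring entries; the divided difference repairs the points with equal ones.\<close>

lemma is_factorial_sigma_plus:
  assumes i: "1 \<le> i" "i \<le> n - 1" and f: "is_factorial n \<eta> f"
  shows "is_factorial n (swap_comp i \<eta>) (sigma_plus i f)"
proof -
  let ?s = "transpose i (Suc i)"
  have lead: "has_lead n \<eta> f" and \<eta>: "\<eta> \<in> compositions n"
    using f by (auto simp: is_factorial_def has_lead_def)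
  have deg: "f \<in> deg_lt n (Suc (weight \<eta>))"
    by (rule has_lead_deg_lt[OF lead])
  have w: "weight (swap_comp i \<eta>) = weight \<eta>"
    by (rule weight_swap[OF \<eta> i])
  have "(\<Sum>j\<in>{1..n}. single (?s j) (lookup \<eta> j)) = swap_comp i \<eta>"
  proof (rule poly_mapping_eqI)
    fix k
    have "lookup (\<Sum>j\<in>{1..n}. single (?s j) (lookup \<eta> j)) k
      = (\<Sum>j\<in>{1..n}. if j = ?s k then lookup \<eta> (?s k) else 0)"
      unfolding lookup_sum by (rule sum.cong) (auto simp: lookup_single when_def)
    also have "\<dots> = lookup \<eta> (?s k)"
      using comp_lookup_0[OF \<eta>] by auto
    finally show "lookup (\<Sum>j\<in>{1..n}. single (?s j) (lookup \<eta> j)) k = lookup (swap_comp i \<eta>) k"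
      by (simp add: lookup_swap_comp)
  qed
  moreover have "has_lead n (\<Sum>j\<in>{1..n}. single (?s j) (lookup \<eta> j)) (swap_poly i f)"
    unfolding swap_poly_def using i
    by (intro psubst_has_lead[OF lead] has_lead_Var) (simp add: transpose_range del: atLeastAtMost_iff)
  ultimately have "has_lead n (swap_comp i \<eta>) (sigma_plus i f)"
    unfolding sigma_plus_def using divdiff_deg_lt[OF i deg]
    by (intro has_lead_add deg_lt_Const_mult) (simp_all add: w)
  moreover have "peval (\<lambda>j. - point n \<gamma> j) (sigma_plus i f) = 0" if \<gamma>: "\<gamma> \<in> comps_lt n (weight \<eta>)" for \<gamma>
  proof -
    let ?p = "\<lambda>j. - point n \<gamma> j"
    have van: "peval ?p f = 0"
      using f \<gamma> by (simp add: is_factorial_def)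
    have \<gamma>c: "\<gamma> \<in> compositions n"
      using \<gamma> by (simp add: comps_lt_def)
    have "peval ?p ((Var i - Var (Suc i)) * divdiff i f) = peval ?p (swap_poly i f - f)"
      using divdiff_mult[OF i deg] by simp
    then have dd: "(point n \<gamma> (Suc i) - point n \<gamma> i) * peval ?p (divdiff i f) = peval ?p (swap_poly i f)"
      by (simp add: peval_simps van)
    have sig: "peval ?p (sigma_plus i f) = peval ?p (swap_poly i f) + r * peval ?p (divdiff i f)"
      by (simp add: sigma_plus_def peval_simps)
    show ?thesis
    proof (cases "lookup \<gamma> i = lookup \<gamma> (Suc i)")
      case True
      \<comment> \<open>As \<open>f\<close> vanishes at the negated point, where x_i - x_(i+1)
        equals -r, the swapped value is -r times the divided difference. The two summands of
        \<open>sigma_plus\<close> cancel.\<close>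
      then have "point n \<gamma> (Suc i) - point n \<gamma> i = - r"
        using point_equal_entries[OF i, of \<gamma>] by (simp add: algebra_simps)
      then show ?thesis
        using dd unfolding sig by simp
    next
      case False
      have "peval ?p (swap_poly i f) = peval (\<lambda>j. - point n \<gamma> (?s j)) f"
        by (simp add: swap_poly_def peval_psubst peval_simps)
      also have "\<dots> = peval (\<lambda>j. - point n (swap_comp i \<gamma>) j) f"
        using point_swap[OF \<gamma>c i False] by (intro peval_cong[OF deg_lt_polys[OF deg]]) simp
      also have "\<dots> = 0"
        using f \<gamma> swap_comp_comp[OF \<gamma>c i] weight_swap[OF \<gamma>c i]
        by (simp add: is_factorial_def comps_lt_def)
      finally have sw: "peval ?p (swap_poly i f) = 0" .
      \<comment> \<open>With unequal entries the two summands vanish separately; for the divided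
        difference this uses that x_i - x_(i+1) is nonzero at the point.\<close>
      moreover have "point n \<gamma> (Suc i) \<noteq> point n \<gamma> i"
        using i by (intro point_inj) auto
      ultimately have "peval ?p (divdiff i f) = 0"
        using dd by simp
      then show ?thesis
        using sw unfolding sig by simp
    qed
  qed
  ultimately show ?thesis
    by (simp add: is_factorial_def w)
qed

text \<open>The factor x_n vanishes at points with last entry 0. At any other point the substitution
  undoes Phi and lands on a zero of \<open>f\<close>: Phi adds exactly one to the weight, so the
  preimage has weight below |eta|.\<close>

lemma is_factorial_Phi_plus:
  assumes n: "n \<ge> 1" and f: "is_factorial n \<eta> f"
  shows "is_factorial n (Phi n \<eta>) (Phi_plus n f)"
proof -
  let ?g = "\<lambda>i. if i = 1 then Var n + 1 else Var (i - 1)"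
  \<comment> \<open>\<open>?\<pi> i\<close> is the index of the variable leading
    \<open>?g i\<close>.\<close>
  let ?\<pi> = "\<lambda>i. if i = 1 then n else i - 1"
  have lead: "has_lead n \<eta> f" and \<eta>: "\<eta> \<in> compositions n"
    using f by (auto simp: is_factorial_def has_lead_def)
  have pol: "f \<in> polys n"
    using has_lead_deg_lt[OF lead] by (rule deg_lt_polys)
  have "single n 1 + (\<Sum>i\<in>{1..n}. single (?\<pi> i) (lookup \<eta> i)) = Phi n \<eta>"
  proof (rule poly_mapping_eqI)
    fix k
    have "lookup (\<Sum>i\<in>{1..n}. single (?\<pi> i) (lookup \<eta> i)) k
      = (\<Sum>i\<in>{1..n}. if i = (if k = n then 1 else k + 1) then
          (if k = n then lookup \<eta> 1 else if 1 \<le> k \<and> k < n then lookup \<eta> (k + 1) else 0) else 0)"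
      unfolding lookup_sum by (rule sum.cong) (auto simp: lookup_single when_def)
    also have "\<dots> = (if k = n then lookup \<eta> 1 else if 1 \<le> k \<and> k < n then lookup \<eta> (k + 1) else 0)"
      using n by auto
    finally show "lookup (single n 1 + (\<Sum>i\<in>{1..n}. single (?\<pi> i) (lookup \<eta> i))) k = lookup (Phi n \<eta>) k"
      by (auto simp: lookup_Phi lookup_add lookup_single when_def)
  qed
  moreover have "has_lead n (single (?\<pi> i) 1) (?g i)" if "i \<in> {1..n}" for i
  proof (cases "i = 1")
    case True
    then show ?thesis
      using n has_lead_Var_plus[of n n 1] by simp
  next
    case False
    with that have "i - 1 \<in> {1..n}"
      by (cases i) (auto simp: Suc_le_eq)
    then show ?thesis
      using False has_lead_Var by simp
  qed
  then have "has_lead n (\<Sum>i\<in>{1..n}. single (?\<pi> i) (lookup \<eta> i)) (psubst ?g f)"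
    by (rule psubst_has_lead[OF lead])
  then have "has_lead n (single n 1 + (\<Sum>i\<in>{1..n}. single (?\<pi> i) (lookup \<eta> i))) (Phi_plus n f)"
    unfolding Phi_plus_def using n by (intro has_lead_mult has_lead_Var) auto
  ultimately have "has_lead n (Phi n \<eta>) (Phi_plus n f)"
    by simp
  moreover have "peval (\<lambda>j. - point n \<gamma> j) (Phi_plus n f) = 0"
    if \<gamma>: "\<gamma> \<in> comps_lt n (weight (Phi n \<eta>))" for \<gamma>
  proof -
    let ?p = "\<lambda>j. - point n \<gamma> j"
    have ev: "peval ?p (Phi_plus n f) = - point n \<gamma> n * peval (\<lambda>i. peval ?p (?g i)) f"
      by (simp add: Phi_plus_def peval_simps peval_psubst)
    show ?thesis
    proof (cases "lookup \<gamma> n = 0")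
      case True
      then show ?thesis
        using point_last_zero[OF n True] ev by simp
    next
      case False
      have "\<gamma> \<in> compositions n"
        using \<gamma> by (simp add: comps_lt_def)
      then obtain \<gamma>' where \<gamma>': "\<gamma>' \<in> compositions n" "\<gamma> = Phi n \<gamma>'"
        using Phi_surj[OF _ n False] by blast
      then have "\<gamma>' \<in> comps_lt n (weight \<eta>)"
        using \<gamma> weight_Phi[OF _ n] \<eta> by (simp add: comps_lt_def)
      then have van: "peval (\<lambda>i. - point n \<gamma>' i) f = 0"
        using f by (simp add: is_factorial_def)
      have "peval (\<lambda>i. peval ?p (?g i)) f = peval (\<lambda>i. - point n \<gamma>' i) f"
      proof (rule peval_cong[OF pol])
        fix i assume i: "i \<in> {1..n}"
        \<comment> \<open>For i = 1 the shift is exact: the last coordinate of the negated point is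
          the negated first coordinate for \<gamma>' minus 1, and \<open>?g\<close> adds 1.\<close>
        show "peval ?p (?g i) = - point n \<gamma>' i"
          using i point_Phi[of "i - 1" n \<gamma>'] point_Phi_last[OF n, of \<gamma>']
          by (auto simp: peval_simps \<gamma>'(2))
      qed
      then show ?thesis
        by (simp add: ev van)
    qed
  qed
  ultimately show ?thesis
    by (simp add: is_factorial_def)
qed

theorem theorem3p13:
  fixes n :: nat and \<eta> :: "nat \<Rightarrow>\<^sub>0 nat"
  assumes "n \<ge> 1" and "\<eta> \<in> compositions n"
  shows "(\<forall>i. 1 \<le> i \<and> i \<le> n - 1 \<longrightarrow>
            fact_monom n (swap_comp i \<eta>) = sigma_plus i (fact_monom n \<eta>)) \<and>
         fact_monom n (Phi n \<eta>) = Phi_plus n (fact_monom n \<eta>)"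
proof (intro conjI allI impI)
  have fac: "is_factorial n \<mu> (fact_monom n \<mu>)" if "\<mu> \<in> compositions n" for \<mu>
    using that by (simp add: fact_monom_eq is_factorial_factorial)
  show "fact_monom n (swap_comp i \<eta>) = sigma_plus i (fact_monom n \<eta>)"
    if "1 \<le> i \<and> i \<le> n - 1" for i
    using that assms swap_comp_comp
    by (intro is_factorial_unique[OF fac is_factorial_sigma_plus[OF _ _ fac]]) auto
  show "fact_monom n (Phi n \<eta>) = Phi_plus n (fact_monom n \<eta>)"
    using assms by (intro is_factorial_unique[OF fac[OF Phi_comp] is_factorial_Phi_plus[OF _ fac]])
qed

end
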